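(* For every non-computable c.e. set $D$ there are c.e. sets $A,B\le_{\mathrm T}D$ such that $A\not\le_{\mathrm{ML}}B$ and $B\not\le_{\mathrm{ML}}A$.
   Context: $B\le_{\mathrm{ML}}A$ means: for every ML-random $Y$, $A\le_{\mathrm T}Y$ implies $B\le_{\mathrm T}Y$. *)

theory Defs
  imports Complex_Main "HOL-Library.Nat_Bijection" "HOL-Library.Sublist"
begin

datatype recf =
    Zero
  | Succ
  | Proj nat
  | Comp recf "recf list"
  | Prim recf recf
  | Mn recf
  | Orc

inductive eval :: "nat set \<Rightarrow> recf \<Rightarrow> nat list \<Rightarrow> nat \<Rightarrow> bool" for X where
  ev_zero: "eval X Zero xs 0"
| ev_succ: "eval X Succ (x # xs) (Suc x)"
| ev_proj: "i < length xs \<Longrightarrow> eval X (Proj i) xs (xs ! i)"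
| ev_comp: "list_all2 (\<lambda>g y. eval X g xs y) gs ys \<Longrightarrow> eval X f ys z
            \<Longrightarrow> eval X (Comp f gs) xs z"
| ev_prim0: "eval X f xs y \<Longrightarrow> eval X (Prim f g) (0 # xs) y"
| ev_primS: "eval X (Prim f g) (n # xs) y \<Longrightarrow> eval X g (y # n # xs) z
             \<Longrightarrow> eval X (Prim f g) (Suc n # xs) z"
| ev_mn: "eval X f (n # xs) 0 \<Longrightarrow> (\<forall>m<n. \<exists>y. eval X f (m # xs) (Suc y))
          \<Longrightarrow> eval X (Mn f) xs n"
| ev_orc: "eval X Orc (x # xs) (if x \<in> X then 1 else 0)"

definition turing_le :: "nat set \<Rightarrow> nat set \<Rightarrow> bool" (infix "\<le>\<^sub>T" 50) where
  "A \<le>\<^sub>T B \<longleftrightarrow> (\<exists>f. \<forall>x. eval B f [x] (if x \<in> A then 1 else 0))"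

definition computable :: "nat set \<Rightarrow> bool" where
  "computable A \<longleftrightarrow> A \<le>\<^sub>T {}"

definition ce :: "nat set \<Rightarrow> bool" where
  "ce A \<longleftrightarrow> (\<exists>f. \<forall>x. x \<in> A \<longleftrightarrow> (\<exists>y. eval {} f [x] y))"

text \<open>Standard computable bijection between binary strings and naturals.\<close>
fun str_code :: "bool list \<Rightarrow> nat" where
  "str_code [] = 0"
| "str_code (b # bs) = 2 * str_code bs + (if b then 2 else 1)"

text \<open>Lebesgue measure of the open set generated by a set S of strings.\<close>
definition open_measure :: "bool list set \<Rightarrow> real" where
  "open_measure S = (SUP k. real (card {\<sigma>. length \<sigma> = k \<and> (\<exists>\<tau>\<in>S. prefix \<tau> \<sigma>)}) / 2 ^ k)"

text \<open>The n-th component of a uniformly c.e. sequence coded by W.\<close>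
definition component :: "nat set \<Rightarrow> nat \<Rightarrow> bool list set" where
  "component W n = {\<sigma>. prod_encode (n, str_code \<sigma>) \<in> W}"

definition ml_test :: "nat set \<Rightarrow> bool" where
  "ml_test W \<longleftrightarrow> ce W \<and> (\<forall>n. open_measure (component W n) \<le> 1 / 2 ^ n)"

definition extends :: "nat set \<Rightarrow> bool list \<Rightarrow> bool" where
  "extends Y \<sigma> \<longleftrightarrow> (\<forall>i < length \<sigma>. (\<sigma> ! i) = (i \<in> Y))"

definition ml_random :: "nat set \<Rightarrow> bool" where
  "ml_random Y \<longleftrightarrow> (\<forall>W. ml_test W \<longrightarrow> \<not> (\<forall>n. \<exists>\<sigma>\<in>component W n. extends Y \<sigma>))"

definition ml_le :: "nat set \<Rightarrow> nat set \<Rightarrow> bool" (infix "\<le>\<^sub>M\<^sub>L" 50) where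
  "B \<le>\<^sub>M\<^sub>L A \<longleftrightarrow> (\<forall>Y. ml_random Y \<longrightarrow> A \<le>\<^sub>T Y \<longrightarrow> B \<le>\<^sub>T Y)"

end

theory Submission
  imports Defs
begin

text \<open>Random sets \<open>Y\<^sub>0\<close>, \<open>Y\<^sub>1\<close> and c.e. sets \<open>C\<^sub>0\<close>, \<open>C\<^sub>1\<close> are approximated simultaneously, with
  \<open>C\<^sub>i\<close> computable from \<open>Y\<^sub>1\<^sub>-\<^sub>i\<close> but not from \<open>Y\<^sub>i\<close>. A requirement tests whether \<open>\<Phi>(Y; x) = 0\<close> holds for
  all \<open>Y\<close> in the current \<open>\<Pi>\<^sup>0\<^sub>1\<close> class of candidates for \<open>Y\<^sub>i\<close>. If it fails for some follower \<open>x\<close>, the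
  class is shrunk to the \<open>Y\<close> with \<open>\<Phi>(Y; x) \<noteq> 0\<close> and \<open>x\<close> is kept out of \<open>C\<^sub>i\<close>. If it holds, \<open>x\<close> is put
  into \<open>C\<^sub>i\<close> as soon as a number below \<open>x\<close> enters \<open>D\<close>; this makes \<open>C\<^sub>i\<close> computable from \<open>D\<close>, and if no
  follower were ever permitted then \<open>D\<close> would be computable. The requirement \<open>p\<close> acts at most once, and
  only while the first \<open>n\<^sub>p\<close> bits of the approximation to \<open>Y\<^sub>1\<^sub>-\<^sub>i\<close> look settled. Since the \<open>n\<^sub>p\<close> are
  distinct, the strings recorded at these actions form a test, which the random set \<open>Y\<^sub>1\<^sub>-\<^sub>i\<close> passes:
  almost always these bits change after the action, so \<open>Y\<^sub>1\<^sub>-\<^sub>i\<close> knows when \<open>C\<^sub>i\<close> has settled.\<close>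

section \<open>Computability on coded types\<close>

text \<open>A bijection with the naturals, so that searches can decode every number without checking
  that it is a code.\<close>

class coded =
  fixes enc :: "'a \<Rightarrow> nat" and dec :: "nat \<Rightarrow> 'a"
  assumes dec_enc [simp]: "dec (enc a) = a" and enc_dec [simp]: "enc (dec n) = n"

lemma enc_eq_iff [simp]: "enc a = enc b \<longleftrightarrow> a = b"
  by (metis dec_enc)

instantiation nat :: coded
begin
definition enc_nat_def: "enc (n :: nat) = n"
definition dec_nat_def: "dec n = (n :: nat)"
instance by standard (simp_all add: enc_nat_def dec_nat_def)
end

lemma enc_nat [simp]: "enc (n :: nat) = n"
  by (simp add: enc_nat_def)

instantiation prod :: (coded, coded) coded
begin
definition enc_prod_def: "enc p = prod_encode (enc (fst p), enc (snd p))"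
definition dec_prod_def: "dec n = map_prod dec dec (prod_decode n)"
instance by standard (simp_all add: enc_prod_def dec_prod_def map_prod_def case_prod_beta)
end

instantiation list :: (coded) coded
begin
definition enc_list_def: "enc xs = list_encode (map enc xs)"
definition dec_list_def: "dec n = map dec (list_decode n)"
instance by standard (simp_all add: enc_list_def dec_list_def comp_def)
end

text \<open>Through this equation cons, head and tail of coded lists reduce to successor,
  predecessor and pairing.\<close>

lemma enc_Cons: "enc (x # xs) = Suc (enc (x, xs))"
  by (simp add: enc_list_def enc_prod_def)

definition rec_fun :: "nat set \<Rightarrow> ('a::coded \<Rightarrow> 'b::coded) \<Rightarrow> bool" where
  "rec_fun X F \<longleftrightarrow> (\<exists>r. \<forall>a. eval X r [enc a] (enc (F a)))"

definition rec_pred :: "nat set \<Rightarrow> ('a::coded \<Rightarrow> bool) \<Rightarrow> bool" where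
  "rec_pred X P \<longleftrightarrow> rec_fun X (\<lambda>a. if P a then 1 else 0 :: nat)"

section \<open>Programs for arithmetic and for the Cantor pairing\<close>

lemma eval_Proj: "i < length xs \<Longrightarrow> y = xs ! i \<Longrightarrow> eval X (Proj i) xs y"
  by (simp add: ev_proj)

lemma eval_Comp1: "eval X g xs y \<Longrightarrow> eval X f [y] z \<Longrightarrow> eval X (Comp f [g]) xs z"
  by (rule ev_comp[where ys="[y]"]) auto

lemma eval_Comp2:
  "eval X g xs y \<Longrightarrow> eval X h xs w \<Longrightarrow> eval X f [y, w] z \<Longrightarrow> eval X (Comp f [g, h]) xs z"
  by (rule ev_comp[where ys="[y, w]"]) auto

lemma ex_eval_add: "\<exists>r. \<forall>a b. eval X r [a, b] (a + b)"
proof (intro exI allI)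
  fix a b
  show "eval X (Prim (Proj 0) (Comp Succ [Proj 0])) [a, b] (a + b)"
  proof (induction a)
    case 0
    show ?case by (rule ev_prim0, rule eval_Proj) simp_all
  next
    case (Suc a)
    show ?case by (rule ev_primS[OF Suc]) (auto intro!: eval_Comp1 eval_Proj ev_succ)
  qed
qed

lemma ex_eval_pred: "\<exists>r. \<forall>a. eval X r [a] (a - 1)"
proof (intro exI allI)
  fix a
  show "eval X (Prim Zero (Proj 1)) [a] (a - 1)"
  proof (induction a)
    case 0
    show ?case by (auto intro: ev_prim0 ev_zero)
  next
    case (Suc a)
    show ?case by (rule ev_primS[OF Suc]) (auto intro!: eval_Proj)
  qed
qed

text \<open>\<open>Prim\<close> recurses on its first argument, so the subtrahend comes
  first.\<close>

lemma ex_eval_diff: "\<exists>r. \<forall>b a. eval X r [b, a] (a - b)"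
proof -
  obtain p where p: "\<And>a. eval X p [a] (a - 1)" using ex_eval_pred by blast
  have "eval X (Prim (Proj 0) (Comp p [Proj 0])) [b, a] (a - b)" for a b
  proof (induction b)
    case 0
    show ?case by (rule ev_prim0, rule eval_Proj) simp_all
  next
    case (Suc b)
    show ?case
      by (rule ev_primS[OF Suc], rule eval_Comp1, rule eval_Proj)
        (use p[of "a - b"] in simp_all)
  qed
  then show ?thesis by blast
qed

lemma ex_eval_triangle: "\<exists>r. \<forall>a. eval X r [a] (triangle a)"
proof -
  obtain p where p: "\<And>a b. eval X p [a, b] (a + b)" using ex_eval_add by blast
  have "eval X (Prim Zero (Comp Succ [Comp p [Proj 0, Proj 1]])) [a] (triangle a)" for a
  proof (induction a)
    case 0
    show ?case by (auto intro: ev_prim0 ev_zero)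
  next
    case (Suc a)
    show ?case
      by (rule ev_primS[OF Suc], rule eval_Comp1, rule eval_Comp2)
        (use p ev_succ[of X "triangle a + a" "[]"] in \<open>auto intro!: eval_Proj\<close>)
  qed
  then show ?thesis by blast
qed

lemma ex_eval_pair: "\<exists>r. \<forall>a b. eval X r [a, b] (prod_encode (a, b))"
proof -
  obtain p where p: "\<And>a b. eval X p [a, b] (a + b)" using ex_eval_add by blast
  obtain t where t: "\<And>a. eval X t [a] (triangle a)" using ex_eval_triangle by blast
  have "eval X (Comp p [Comp t [p], Proj 0]) [a, b] (prod_encode (a, b))" for a b
    unfolding prod_encode_def by (auto intro!: eval_Comp2 eval_Comp1 eval_Proj p t)
  then show ?thesis by blast
qed

lemma triangle_mono: "m \<le> n \<Longrightarrow> triangle m \<le> triangle n"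
  unfolding triangle_def by (intro div_le_mono mult_le_mono) auto

text \<open>The Cantor pairing puts \<open>(a, b)\<close> at \<open>triangle (a + b) + a\<close>, so
  \<open>a + b\<close> is the index of the interval between triangular numbers that contains the
  code.\<close>

lemma triangle_root: "(LEAST k. prod_encode (a, b) < triangle (Suc k)) = a + b"
proof (rule Least_equality)
  show "prod_encode (a, b) < triangle (Suc (a + b))"
    by (simp add: prod_encode_def)
  fix k assume k: "prod_encode (a, b) < triangle (Suc k)"
  show "a + b \<le> k"
  proof (rule ccontr)
    assume "\<not> a + b \<le> k"
    then have "triangle (Suc k) \<le> triangle (a + b)" by (intro triangle_mono) simp
    with k show False by (simp add: prod_encode_def)
  qed
qed

lemma eval_Mn_Least:
  assumes "\<And>k. eval X r (k # xs) (F k)" and "\<exists>k. F k = 0"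
  shows "eval X (Mn r) xs (LEAST k. F k = 0)"
proof (rule ev_mn)
  show "eval X r ((LEAST k. F k = 0) # xs) 0"
    using assms(1)[of "LEAST k. F k = 0"] LeastI_ex[OF assms(2)] by simp
  show "\<forall>m<LEAST k. F k = 0. \<exists>y. eval X r (m # xs) (Suc y)"
  proof (intro allI impI)
    fix m assume "m < (LEAST k. F k = 0)"
    then have "F m \<noteq> 0" by (rule not_less_Least)
    then obtain y where "F m = Suc y" by (cases "F m") auto
    with assms(1)[of m] show "\<exists>y. eval X r (m # xs) (Suc y)" by auto
  qed
qed

lemma ex_eval_unpair:
  "\<exists>r. \<forall>n. eval X r [n] (fst (prod_decode n))"
  "\<exists>r. \<forall>n. eval X r [n] (snd (prod_decode n))"
proof -
  obtain d where d: "\<And>a b. eval X d [b, a] (a - b)" using ex_eval_diff by blast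
  obtain t where t: "\<And>a. eval X t [a] (triangle a)" using ex_eval_triangle by blast
  \<comment> \<open>The computed difference is 0 exactly when \<open>n < triangle (Suc k)\<close>,
    so minimization finds the sum of the components; subtractions then yield each of them.\<close>
  define r where "r = Comp d [Comp t [Comp Succ [Proj 0]], Comp Succ [Proj 1]]"
  have r: "eval X r [k, n] (Suc n - triangle (Suc k))" for k n
    unfolding r_def by (rule eval_Comp2 eval_Comp1 eval_Proj ev_succ d t | simp)+
  have root: "eval X (Mn r) [prod_encode (a, b)] (a + b)" for a b
  proof -
    have "\<exists>k. Suc (prod_encode (a, b)) - triangle (Suc k) = 0"
      by (rule exI[of _ "a + b"]) (simp add: prod_encode_def)
    from eval_Mn_Least[OF r this] triangle_root[of a b]
    show ?thesis by (simp add: less_eq_Suc_le)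
  qed
  define f where "f = Comp d [Comp t [Mn r], Proj 0]"
  have f: "eval X f [prod_encode (a, b)] a" for a b
  proof -
    have "eval X f [prod_encode (a, b)] (prod_encode (a, b) - triangle (a + b))"
      unfolding f_def by (rule eval_Comp2 eval_Comp1 eval_Proj d t root | simp)+
    then show ?thesis by (simp add: prod_encode_def)
  qed
  have "eval X (Comp d [f, Mn r]) [prod_encode (a, b)] (a + b - a)" for a b
    by (rule eval_Comp2 f root d)+
  then have "eval X (Comp d [f, Mn r]) [prod_encode (a, b)] b" for a b by simp
  with f have "eval X f [n] (fst (prod_decode n))"
    "eval X (Comp d [f, Mn r]) [n] (snd (prod_decode n))" for n
    by (metis prod.collapse prod_decode_inverse)+
  then show "\<exists>r. \<forall>n. eval X r [n] (fst (prod_decode n))"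
    "\<exists>r. \<forall>n. eval X r [n] (snd (prod_decode n))" by blast+
qed

lemma ex_eval_comp1:
  assumes "\<exists>r. \<forall>b. eval X r [b] (f b)" and "\<exists>r. \<forall>a. eval X r [e a] (g a)"
  shows "\<exists>r. \<forall>a. eval X r [e a] (f (g a))"
proof -
  from assms obtain r s where "\<And>b. eval X r [b] (f b)" "\<And>a. eval X s [e a] (g a)" by blast
  then have "\<forall>a. eval X (Comp r [s]) [e a] (f (g a))" by (blast intro: eval_Comp1)
  then show ?thesis ..
qed

lemma ex_eval_comp2:
  assumes "\<exists>r. \<forall>b c. eval X r [b, c] (f b c)"
    and "\<exists>r. \<forall>a. eval X r [e a] (g a)" and "\<exists>r. \<forall>a. eval X r [e a] (h a)"
  shows "\<exists>r. \<forall>a. eval X r [e a] (f (g a) (h a))"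
proof -
  from assms obtain r s t where "\<And>b c. eval X r [b, c] (f b c)"
    "\<And>a. eval X s [e a] (g a)" "\<And>a. eval X t [e a] (h a)" by blast
  then have "\<forall>a. eval X (Comp r [s, t]) [e a] (f (g a) (h a))" by (blast intro: eval_Comp2)
  then show ?thesis ..
qed

lemma ex_eval_Suc: "\<exists>r. \<forall>a. eval X r [a] (Suc a)"
  using ev_succ by blast

lemma ex_eval_Orc: "\<exists>r. \<forall>a. eval X r [a] (if a \<in> X then 1 else 0)"
  using ev_orc by blast

section \<open>Closure properties of computable functions\<close>

lemma rec_fun_id: "rec_fun X (\<lambda>a. a)"
  unfolding rec_fun_def by (rule exI[of _ "Proj 0"]) (auto intro: eval_Proj)

lemma rec_fun_comp: "rec_fun X f \<Longrightarrow> rec_fun X g \<Longrightarrow> rec_fun X (\<lambda>a. f (g a))"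
  unfolding rec_fun_def
proof -
  assume "\<exists>r. \<forall>a. eval X r [enc a] (enc (f a))" "\<exists>r. \<forall>a. eval X r [enc a] (enc (g a))"
  then obtain r s where "\<And>a. eval X r [enc a] (enc (f a))" "\<And>a. eval X s [enc a] (enc (g a))"
    by blast
  then have "\<forall>a. eval X (Comp r [s]) [enc a] (enc (f (g a)))" by (blast intro: eval_Comp1)
  then show "\<exists>r. \<forall>a. eval X r [enc a] (enc (f (g a)))" ..
qed

lemma rec_fun_const: "rec_fun X (\<lambda>a. c)"
proof -
  have "\<exists>r. \<forall>xs. eval X r xs n" for n
  proof (induction n)
    case 0
    then show ?case by (auto intro: ev_zero)
  next
    case (Suc n)
    then obtain r where "\<And>xs. eval X r xs n" by blast
    then have "\<forall>xs. eval X (Comp Succ [r]) xs (Suc n)" by (blast intro: eval_Comp1 ev_succ)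
    then show ?case ..
  qed
  then show ?thesis unfolding rec_fun_def by blast
qed

lemma rec_fun_Pair: "rec_fun X f \<Longrightarrow> rec_fun X g \<Longrightarrow> rec_fun X (\<lambda>a. (f a, g a))"
  unfolding rec_fun_def enc_prod_def fst_conv snd_conv
  by (rule ex_eval_comp2[OF ex_eval_pair])

lemma rec_fun_fst: "rec_fun X f \<Longrightarrow> rec_fun X (\<lambda>a. fst (f a))"
  unfolding rec_fun_def by (drule ex_eval_comp1[OF ex_eval_unpair(1)]) (simp add: enc_prod_def)

lemma rec_fun_snd: "rec_fun X f \<Longrightarrow> rec_fun X (\<lambda>a. snd (f a))"
  unfolding rec_fun_def by (drule ex_eval_comp1[OF ex_eval_unpair(2)]) (simp add: enc_prod_def)

lemma rec_fun_enc: "rec_fun X f \<Longrightarrow> rec_fun X (\<lambda>a. enc (f a))"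
  unfolding rec_fun_def by simp

lemma rec_fun_dec: "rec_fun X f \<Longrightarrow> rec_fun X (\<lambda>a. dec (f a))"
  unfolding rec_fun_def by simp

lemma rec_fun_Suc: "rec_fun X f \<Longrightarrow> rec_fun X (\<lambda>a. Suc (f a))"
  unfolding rec_fun_def enc_nat by (rule ex_eval_comp1[OF ex_eval_Suc])

lemma rec_fun_rec_nat:
  assumes "rec_fun X g" and "rec_fun X (\<lambda>z. h (fst z) (fst (snd z)) (snd (snd z)))"
    and "rec_fun X k"
  shows "rec_fun X (\<lambda>a. rec_nat (g a) (h a) (k a))"
proof -
  obtain rg where g: "\<And>a. eval X rg [enc a] (enc (g a))"
    using assms(1) unfolding rec_fun_def by blast
  obtain rh where "\<And>z. eval X rh [enc z] (enc (h (fst z) (fst (snd z)) (snd (snd z))))"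
    using assms(2) unfolding rec_fun_def by blast
  from this[of "(a, n, y)" for a n y]
  have h: "\<And>a n y. eval X rh [prod_encode (enc a, prod_encode (n, enc y))] (enc (h a n y))"
    by (simp add: enc_prod_def)
  obtain rk where k: "\<And>a. eval X rk [enc a] (k a)"
    using assms(3) unfolding rec_fun_def by auto
  obtain p where p: "\<And>a b. eval X p [a, b] (prod_encode (a, b))" using ex_eval_pair by blast
  \<comment> \<open>\<open>Prim\<close> supplies value, counter and parameter in this order; the
    projections rearrange them into the code of \<open>(a, n, y)\<close>.\<close>
  define r where "r = Prim rg (Comp rh [Comp p [Proj 2, Comp p [Proj 1, Proj 0]]])"
  have r: "eval X r [n, enc a] (enc (rec_nat (g a) (h a) n))" for n a
    unfolding r_def
  proof (induction n)
    case 0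
    show ?case by (auto intro: ev_prim0 g)
  next
    case (Suc n)
    show ?case
      by (rule ev_primS[OF Suc])
        (rule eval_Comp2 eval_Comp1 eval_Proj p
          | simp add: h del: prod_encode_eq)+
  qed
  have "eval X (Comp r [rk, Proj 0]) [enc a] (enc (rec_nat (g a) (h a) (k a)))" for a
    by (rule eval_Comp2[OF k eval_Proj r]) auto
  then show ?thesis unfolding rec_fun_def by blast
qed

text \<open>A case distinction is a primitive recursion of length 0 or 1.\<close>

lemma rec_fun_if:
  assumes "rec_pred X P" "rec_fun X f" "rec_fun X g"
  shows "rec_fun X (\<lambda>a. if P a then f a else g a)"
proof -
  have "rec_fun X (\<lambda>a. rec_nat (g a) (\<lambda>_ _. f a) (if P a then 1 else 0))"
    using assms unfolding rec_pred_def
    by (rule_tac rec_fun_rec_nat) (auto intro: rec_fun_comp[OF assms(2) rec_fun_fst[OF rec_fun_id]])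
  also have "(\<lambda>a. rec_nat (g a) (\<lambda>_ _. f a) (if P a then 1 else 0)) = (\<lambda>a. if P a then f a else g a)"
    by auto
  finally show ?thesis .
qed

lemma rec_fun_Least:
  assumes "rec_pred X (\<lambda>z. P (fst z) (snd z))" and "\<And>a. \<exists>n. P a n"
  shows "rec_fun X (\<lambda>a. LEAST n :: nat. P a n)"
proof -
  have "rec_fun X (\<lambda>z. if P (fst z) (snd z) then 0 else 1 :: nat)"
    using assms(1) by (intro rec_fun_if rec_fun_const)
  then obtain t where "\<And>z. eval X t [enc z] (if P (fst z) (snd z) then 0 else 1)"
    unfolding rec_fun_def enc_nat by blast
  from this[of "(a, n)" for a n]
  have t: "\<And>a n. eval X t [prod_encode (enc a, n)] (if P a n then 0 else 1)"
    by (simp add: enc_prod_def)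
  obtain p where p: "\<And>a b. eval X p [a, b] (prod_encode (a, b))" using ex_eval_pair by blast
  have *: "eval X (Comp t [Comp p [Proj 1, Proj 0]]) [n, enc a] (if P a n then 0 else 1)" for a n
    by (rule eval_Comp2 eval_Comp1 eval_Proj p | simp add: t del: prod_encode_eq)+
  have "eval X (Mn (Comp t [Comp p [Proj 1, Proj 0]])) [enc a] (LEAST n. P a n)" for a
  proof -
    have eq: "(if P a n then 0 else 1 :: nat) = 0 \<longleftrightarrow> P a n" for n by simp
    show ?thesis using eval_Mn_Least[OF *, of a] assms(2)[of a] unfolding eq by blast
  qed
  then show ?thesis unfolding rec_fun_def by auto
qed

section \<open>Computable predicates and bounded quantifiers\<close>

lemma rec_pred_comp: "rec_pred X P \<Longrightarrow> rec_fun X f \<Longrightarrow> rec_pred X (\<lambda>a. P (f a))"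
  unfolding rec_pred_def by (rule rec_fun_comp)

lemma rec_pred_const: "rec_pred X (\<lambda>a. Q)"
  unfolding rec_pred_def by (rule rec_fun_const)

lemma rec_pred_not: "rec_pred X P \<Longrightarrow> rec_pred X (\<lambda>a. \<not> P a)"
proof -
  assume "rec_pred X P"
  then have "rec_fun X (\<lambda>a. if P a then 0 else 1 :: nat)" by (intro rec_fun_if rec_fun_const)
  also have "(\<lambda>a. if P a then 0 else 1 :: nat) = (\<lambda>a. if \<not> P a then 1 else 0)"
    by auto
  finally show ?thesis unfolding rec_pred_def .
qed

lemma rec_pred_conj: "rec_pred X P \<Longrightarrow> rec_pred X Q \<Longrightarrow> rec_pred X (\<lambda>a. P a \<and> Q a)"
proof -
  assume "rec_pred X P" "rec_pred X Q"
  then have "rec_fun X (\<lambda>a. if P a then (if Q a then 1 else 0) else 0 :: nat)"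
    by (intro rec_fun_if rec_fun_const)
  also have "(\<lambda>a. if P a then (if Q a then 1 else 0) else 0 :: nat) = (\<lambda>a. if P a \<and> Q a then 1 else 0)"
    by auto
  finally show ?thesis unfolding rec_pred_def .
qed

lemma rec_pred_disj:
  assumes "rec_pred X P" "rec_pred X Q"
  shows "rec_pred X (\<lambda>a. P a \<or> Q a)"
  using rec_pred_not[OF rec_pred_conj[OF rec_pred_not[OF assms(1)] rec_pred_not[OF assms(2)]]]
  by simp

lemma rec_pred_imp:
  assumes "rec_pred X P" "rec_pred X Q"
  shows "rec_pred X (\<lambda>a. P a \<longrightarrow> Q a)"
  using rec_pred_disj[OF rec_pred_not[OF assms(1)] assms(2)] by simp

lemma rec_pred_if:
  assumes "rec_pred X P" "rec_pred X Q" "rec_pred X R"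
  shows "rec_pred X (\<lambda>a. if P a then Q a else R a)"
  using rec_pred_disj[OF rec_pred_conj[OF assms(1,2)] rec_pred_conj[OF rec_pred_not[OF assms(1)] assms(3)]]
  by (simp add: if_bool_eq_disj)

lemma rec_fun_add:
  fixes f g :: "'a::coded \<Rightarrow> nat"
  shows "rec_fun X f \<Longrightarrow> rec_fun X g \<Longrightarrow> rec_fun X (\<lambda>a. f a + g a)"
  unfolding rec_fun_def enc_nat by (rule ex_eval_comp2[OF ex_eval_add])

lemma rec_fun_diff:
  fixes f g :: "'a::coded \<Rightarrow> nat"
  shows "rec_fun X f \<Longrightarrow> rec_fun X g \<Longrightarrow> rec_fun X (\<lambda>a. f a - g a)"
  unfolding rec_fun_def enc_nat by (rule ex_eval_comp2[OF ex_eval_diff])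

lemma rec_pred_eq_0:
  assumes "rec_fun X f"
  shows "rec_pred X (\<lambda>a. f a = (0 :: nat))"
proof -
  have "rec_fun X (\<lambda>a. 1 - f a)" by (intro rec_fun_diff rec_fun_const assms)
  also have "(\<lambda>a. 1 - f a) = (\<lambda>a. if f a = 0 then 1 else 0)" by auto
  finally show ?thesis unfolding rec_pred_def .
qed

lemma rec_pred_le:
  fixes f g :: "'a::coded \<Rightarrow> nat"
  assumes "rec_fun X f" "rec_fun X g"
  shows "rec_pred X (\<lambda>a. f a \<le> g a)"
  using rec_pred_eq_0[OF rec_fun_diff[OF assms]] by simp

lemma rec_pred_less:
  fixes f g :: "'a::coded \<Rightarrow> nat"
  assumes "rec_fun X f" "rec_fun X g"
  shows "rec_pred X (\<lambda>a. f a < g a)"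
  using rec_pred_le[OF rec_fun_Suc[OF assms(1)] assms(2)] by (simp add: Suc_le_eq)

lemma rec_pred_eq:
  fixes f g :: "'a::coded \<Rightarrow> 'b::coded"
  assumes "rec_fun X f" "rec_fun X g"
  shows "rec_pred X (\<lambda>a. f a = g a)"
proof -
  have "rec_pred X (\<lambda>a. enc (f a) \<le> enc (g a) \<and> enc (g a) \<le> enc (f a))"
    by (intro rec_pred_conj rec_pred_le rec_fun_enc assms)
  also have "(\<lambda>a. enc (f a) \<le> enc (g a) \<and> enc (g a) \<le> enc (f a)) = (\<lambda>a. f a = g a)"
    by (auto simp: order_eq_iff[symmetric])
  finally show ?thesis .
qed

lemma rec_pred_ex_less:
  fixes b :: "'a::coded \<Rightarrow> nat"
  assumes P: "rec_pred X (\<lambda>z. P (fst z) (snd z))" and b: "rec_fun X b"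
  shows "rec_pred X (\<lambda>a. \<exists>i<b a. P a i)"
proof -
  \<comment> \<open>The bound \<open>b a\<close> itself ends the search, which is therefore total;
    the quantifier holds iff the search stops earlier.\<close>
  define l where "l a = (LEAST i. b a \<le> i \<or> P a i)" for a
  have "rec_fun X l" unfolding l_def
    by (rule rec_fun_Least)
      (auto intro!: rec_pred_disj rec_pred_le rec_fun_snd rec_fun_id P rec_fun_comp[OF b rec_fun_fst[OF rec_fun_id]])
  then have "rec_pred X (\<lambda>a. l a < b a)" by (intro rec_pred_less b)
  moreover have "l a < b a \<longleftrightarrow> (\<exists>i<b a. P a i)" for a
  proof
    assume "l a < b a"
    moreover have "b a \<le> l a \<or> P a (l a)" unfolding l_def by (rule LeastI[of _ "b a"]) simp
    ultimately show "\<exists>i<b a. P a i" by auto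
  next
    assume "\<exists>i<b a. P a i"
    then obtain i where i: "i < b a" "P a i" by blast
    then have "l a \<le> i" unfolding l_def by (intro Least_le) simp
    with i show "l a < b a" by simp
  qed
  ultimately show ?thesis by simp
qed

lemma rec_pred_all_less:
  fixes b :: "'a::coded \<Rightarrow> nat"
  assumes "rec_pred X (\<lambda>z. P (fst z) (snd z))" and "rec_fun X b"
  shows "rec_pred X (\<lambda>a. \<forall>i<b a. P a i)"
  using rec_pred_not[OF rec_pred_ex_less[OF rec_pred_not[OF assms(1)] assms(2)]] by simp

lemma rec_pred_mem_oracle: "rec_fun X f \<Longrightarrow> rec_pred X (\<lambda>a. f a \<in> X)"
  unfolding rec_fun_def rec_pred_def enc_nat by (rule ex_eval_comp1[OF ex_eval_Orc])

section \<open>Computable operations on numbers, lists and bits\<close>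

lemma rec_fun_mult:
  fixes f g :: "'a::coded \<Rightarrow> nat"
  assumes f: "rec_fun X f" and g: "rec_fun X g"
  shows "rec_fun X (\<lambda>a. f a * g a)"
proof -
  have "n * m = rec_nat 0 (\<lambda>_ y. y + m) n" for n m :: nat
    by (induction n) auto
  then show ?thesis
    by (simp only:) (intro rec_fun_rec_nat rec_fun_add rec_fun_const rec_fun_comp[OF g] f
        rec_fun_fst[OF rec_fun_id] rec_fun_snd rec_fun_id)
qed

lemma rec_fun_Cons: "rec_fun X f \<Longrightarrow> rec_fun X g \<Longrightarrow> rec_fun X (\<lambda>a. f a # g a)"
  using rec_fun_Suc[OF rec_fun_enc[OF rec_fun_Pair[of X f g]]]
  unfolding rec_fun_def by (simp add: enc_Cons)

lemma dec_enc_list: "dec (enc (x # xs) - 1) = (x, xs)"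
  by (simp add: enc_Cons)

lemma rec_fun_tl:
  assumes "rec_fun X f"
  shows "rec_fun X (\<lambda>a. tl (f a))"
proof -
  have "tl xs = (if xs = [] then [] else snd (dec (enc xs - 1) :: 'b \<times> 'b list))" for xs :: "'b list"
    by (cases xs) (simp_all add: dec_enc_list del: One_nat_def)
  then show ?thesis
    by (simp only:) (intro rec_fun_if rec_pred_eq rec_fun_const rec_fun_snd rec_fun_dec rec_fun_diff
        rec_fun_enc assms)
qed

lemma rec_fun_hd:
  assumes "rec_fun X f"
  shows "rec_fun X (\<lambda>a. hd (f a))"
proof -
  \<comment> \<open>\<open>hd []\<close> is unspecified but fixed, so a constant function covers the
    empty list.\<close>
  have "hd xs = (if xs = [] then hd [] else fst (dec (enc xs - 1) :: 'b \<times> 'b list))" for xs :: "'b list"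
    by (cases xs) (simp_all add: dec_enc_list del: One_nat_def)
  then have "(\<lambda>a. hd (f a)) = (\<lambda>a. if f a = [] then hd [] else fst (dec (enc (f a) - 1) :: 'b \<times> 'b list))"
    by (rule ext)
  then show ?thesis
    by (simp only:) (intro rec_fun_if rec_pred_eq rec_fun_const rec_fun_fst rec_fun_dec rec_fun_diff
        rec_fun_enc assms)
qed

lemma rec_fun_drop:
  assumes "rec_fun X n" "rec_fun X f"
  shows "rec_fun X (\<lambda>a. drop (n a) (f a))"
proof -
  have "drop k xs = rec_nat xs (\<lambda>_. tl) k" for k and xs :: "'b list"
  proof (induction k)
    case (Suc k)
    then show ?case by (metis drop_Suc nat.rec(2) tl_drop)
  qed simp
  then show ?thesis
    by (simp only:) (intro rec_fun_rec_nat rec_fun_tl rec_fun_snd rec_fun_id assms)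
qed

lemma rec_fun_length:
  assumes f: "rec_fun X f"
  shows "rec_fun X (\<lambda>a. length (f a))"
proof -
  have "length xs = (LEAST k. drop k xs = [])" for xs :: "'b list"
    by (rule Least_equality[symmetric]) auto
  moreover have "rec_fun X (\<lambda>a. LEAST k. drop k (f a) = [])"
    by (rule rec_fun_Least)
      (intro rec_pred_eq rec_fun_drop rec_fun_const rec_fun_snd rec_fun_id
        rec_fun_comp[OF f rec_fun_fst[OF rec_fun_id]], meson drop_all order_refl)
  ultimately show ?thesis by simp
qed

lemma rec_pred_ex_set:
  assumes P: "rec_pred X (\<lambda>z. P (fst z) (snd z))" and f: "rec_fun X f"
  shows "rec_pred X (\<lambda>a. \<exists>x\<in>set (f a). P a x)"
proof -
  have "(\<lambda>a. \<exists>x\<in>set (f a). P a x) = (\<lambda>a. \<exists>l<length (f a). P a (hd (drop l (f a))))"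
    by (rule ext) (metis hd_drop_conv_nth in_set_conv_nth)
  moreover have "rec_pred X (\<lambda>z. P (fst z) (hd (drop (snd z) (f (fst z)))))"
    using rec_pred_comp[OF P, of "\<lambda>z. (fst z, hd (drop (snd z) (f (fst z))))"]
    by (simp add: rec_fun_Pair rec_fun_hd rec_fun_drop rec_fun_fst rec_fun_snd rec_fun_id
        rec_fun_comp[OF f rec_fun_fst[OF rec_fun_id]])
  ultimately show ?thesis
    using rec_pred_ex_less[OF _ rec_fun_length[OF f], of "\<lambda>a l. P a (hd (drop l (f a)))"] by simp
qed

lemma rec_pred_mem:
  assumes "rec_fun X g" and f: "rec_fun X f"
  shows "rec_pred X (\<lambda>a. g a \<in> set (f a))"
proof -
  have "(\<lambda>a. g a \<in> set (f a)) = (\<lambda>a. \<exists>x\<in>set (f a). x = g a)" by auto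
  moreover have "rec_pred X (\<lambda>a. \<exists>x\<in>set (f a). x = g a)"
    by (intro rec_pred_ex_set rec_pred_eq rec_fun_snd rec_fun_id f
        rec_fun_comp[OF assms(1) rec_fun_fst[OF rec_fun_id]])
  ultimately show ?thesis by simp
qed

lemma rec_fun_power:
  fixes f g :: "'a::coded \<Rightarrow> nat"
  assumes f: "rec_fun X f" and g: "rec_fun X g"
  shows "rec_fun X (\<lambda>a. f a ^ g a)"
proof -
  have "n ^ m = rec_nat 1 (\<lambda>_ y. y * n) m" for n m :: nat
    by (induction m) auto
  then show ?thesis
    by (simp only:) (intro rec_fun_rec_nat rec_fun_mult rec_fun_const rec_fun_snd rec_fun_id g
        rec_fun_comp[OF f rec_fun_fst[OF rec_fun_id]])
qed

lemma rec_fun_div: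
  fixes f g :: "'a::coded \<Rightarrow> nat"
  assumes f: "rec_fun X f" and g: "rec_fun X g"
  shows "rec_fun X (\<lambda>a. f a div g a)"
proof -
  have div: "n div m = (LEAST q. m = 0 \<or> n < Suc q * m)" for n m :: nat
  proof (cases "m = 0")
    case False
    then show ?thesis
      by (intro Least_equality[symmetric])
        (use dividend_less_div_times[of m n] in
          \<open>auto simp del: mult_Suc simp flip: mult_Suc dest!: less_mult_imp_div_less\<close>)
  qed (simp add: Least_eq_0)
  have "\<exists>q. m = 0 \<or> n < Suc q * m" for n m :: nat
    by (rule exI[of _ n]) (cases m, auto)
  then have "rec_fun X (\<lambda>a. LEAST q. g a = 0 \<or> f a < Suc q * g a)"
    by (intro rec_fun_Least rec_pred_disj rec_pred_less rec_pred_eq rec_fun_mult rec_fun_Suc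
        rec_fun_const rec_fun_snd rec_fun_id rec_fun_comp[OF f rec_fun_fst[OF rec_fun_id]]
        rec_fun_comp[OF g rec_fun_fst[OF rec_fun_id]])
  then show ?thesis by (simp only: div)
qed

lemma rec_fun_mod:
  fixes f g :: "'a::coded \<Rightarrow> nat"
  assumes f: "rec_fun X f" and g: "rec_fun X g"
  shows "rec_fun X (\<lambda>a. f a mod g a)"
  unfolding minus_mult_div_eq_mod[symmetric] by (intro rec_fun_diff rec_fun_mult rec_fun_div f g)

lemma rec_pred_bit:
  fixes f g :: "'a::coded \<Rightarrow> nat"
  assumes f: "rec_fun X f" and g: "rec_fun X g"
  shows "rec_pred X (\<lambda>a. bit (f a) (g a))"
  unfolding bit_iff_odd odd_iff_mod_2_eq_one
  by (intro rec_pred_eq rec_fun_mod rec_fun_div rec_fun_power rec_fun_const f g)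

text \<open>A computable listing of a bounded set. Its length counts the solutions, which is how
  measures of clopen sets are computed later.\<close>

definition sel :: "(nat \<Rightarrow> bool) \<Rightarrow> nat \<Rightarrow> nat list" where
  "sel P b = rec_nat [] (\<lambda>n r. if P n then n # r else r) b"

lemma set_sel: "set (sel P b) = {n. n < b \<and> P n}"
  unfolding sel_def by (induction b) (auto simp: less_Suc_eq)

lemma length_sel: "length (sel P b) = card {n. n < b \<and> P n}"
proof -
  have "distinct (sel P b)"
  proof (induction b)
    case (Suc b)
    then show ?case using set_sel[of P b] by (auto simp: sel_def)
  qed (simp add: sel_def)
  then show ?thesis by (metis distinct_card set_sel)
qed

lemma rec_fun_sel:
  assumes P: "rec_pred X (\<lambda>z. P (fst z) (snd z))" and b: "rec_fun X b"
  shows "rec_fun X (\<lambda>a. sel (P a) (b a))"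
proof -
  have "rec_pred X (\<lambda>z :: 'a \<times> nat \<times> nat list. P (fst z) (fst (snd z)))"
    using rec_pred_comp[OF P, of "\<lambda>z :: 'a \<times> nat \<times> nat list. (fst z, fst (snd z))"]
    by (simp add: rec_fun_Pair rec_fun_fst rec_fun_snd rec_fun_id)
  then show ?thesis
    unfolding sel_def
    by (intro rec_fun_rec_nat rec_fun_if rec_fun_Cons rec_fun_const rec_fun_fst rec_fun_snd
        rec_fun_id b)
qed

lemmas rec_intros =
  rec_fun_const rec_pred_const rec_fun_id
  rec_fun_Pair rec_fun_fst rec_fun_snd rec_fun_enc rec_fun_dec rec_fun_Suc rec_fun_if
  rec_pred_not rec_pred_conj rec_pred_disj rec_pred_imp rec_pred_if rec_fun_add rec_fun_diff
  rec_pred_le rec_pred_less rec_pred_eq rec_pred_ex_less rec_pred_all_less rec_fun_mult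
  rec_fun_Cons rec_fun_tl rec_fun_hd rec_fun_drop rec_fun_length rec_pred_ex_set rec_pred_mem
  rec_fun_power rec_fun_div rec_fun_mod rec_pred_bit rec_fun_sel

subsection \<open>Finite initial segments of sets, coded as numbers\<close>

text \<open>Membership of \<open>i\<close> is bit \<open>i\<close>, so truncating a segment is
  reduction modulo a power of two.\<close>

fun pre :: "nat set \<Rightarrow> nat \<Rightarrow> nat" where
  "pre Y 0 = 0"
| "pre Y (Suc n) = pre Y n + (if n \<in> Y then 2 ^ n else 0)"

lemma pre_less: "pre Y n < 2 ^ n"
  by (induction n) auto

lemma bit_pre [simp]: "bit (pre Y n) i \<longleftrightarrow> i < n \<and> i \<in> Y"
proof (induction n)
  case (Suc n)
  have "\<not> bit (pre Y n) n"
    using pre_less[of Y n] by (simp add: bit_iff_odd)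
  then have "pre Y n + 2 ^ n = set_bit n (pre Y n)"
    by (simp add: set_bit_eq)
  then show ?case using Suc by (auto simp: bit_set_bit_iff less_Suc_eq)
qed simp

lemma bit_mod_power: "bit (m mod 2 ^ n) i \<longleftrightarrow> i < n \<and> bit m i" for m :: nat
  by (simp flip: take_bit_eq_mod add: bit_take_bit_iff)

lemma pre_mod: "n \<le> s \<Longrightarrow> pre Y s mod 2 ^ n = pre Y n"
  by (rule bit_eqI) (auto simp: bit_mod_power)

lemma pre_empty [simp]: "pre {} n = 0"
  by (induction n) auto

lemma rec_fun_pre: "rec_fun Y n \<Longrightarrow> rec_fun Y (\<lambda>a. pre Y (n a))"
proof -
  assume n: "rec_fun Y n"
  have "pre Y k = rec_nat 0 (\<lambda>k y. y + (if k \<in> Y then 2 ^ k else 0)) k" for k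
    by (induction k) auto
  then show ?thesis
    by (simp only:) (intro rec_fun_rec_nat rec_intros rec_pred_mem_oracle n)
qed

lemma mod_mod_power: "n \<le> s \<Longrightarrow> m mod 2 ^ s mod 2 ^ n = m mod 2 ^ n" for m :: nat
  by (simp add: le_imp_power_dvd mod_mod_cancel)

section \<open>Derivations as finite objects\<close>

text \<open>A tag with a payload, so that the rule to be checked can be read off by decoding the
  number.\<close>

fun rc :: "recf \<Rightarrow> nat" where
  "rc Zero = enc (0 :: nat, 0 :: nat)"
| "rc Succ = enc (1 :: nat, 0 :: nat)"
| "rc (Proj i) = enc (2 :: nat, i)"
| "rc (Comp f gs) = enc (3 :: nat, enc (rc f, map rc gs))"
| "rc (Prim f g) = enc (4 :: nat, enc (rc f, rc g))"
| "rc (Mn f) = enc (5 :: nat, rc f)"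
| "rc Orc = enc (6 :: nat, 0 :: nat)"

type_synonym entry = "nat \<times> nat list \<times> nat"

text \<open>An entry \<open>(rc r, xs, y)\<close> stands for the judgement \<open>eval X r xs y\<close>, where only the first \<open>s\<close>
  bits of \<open>X\<close>, given by the number \<open>m\<close>, may be queried; the premises are looked up in \<open>T\<close>.\<close>

definition justified :: "nat \<Rightarrow> nat \<Rightarrow> entry list \<Rightarrow> entry \<Rightarrow> bool" where
  "justified s m T E = (let c = fst E; xs = fst (snd E); y = snd (snd E);
      tag = fst (dec c :: nat \<times> nat); a = snd (dec c :: nat \<times> nat) in
    if tag = 0 then y = 0
    else if tag = 1 then xs \<noteq> [] \<and> y = Suc (hd xs)
    else if tag = 2 then a < length xs \<and> y = hd (drop a xs)
    else if tag = 3 then let f = fst (dec a :: nat \<times> nat list); gs = snd (dec a :: nat \<times> nat list) in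
      \<exists>E'\<in>set T. fst E' = f \<and> snd (snd E') = y \<and> length (fst (snd E')) = length gs \<and>
        (\<forall>j<length gs. (hd (drop j gs), xs, hd (drop j (fst (snd E')))) \<in> set T)
    else if tag = 4 then let f = fst (dec a :: nat \<times> nat); g = snd (dec a :: nat \<times> nat) in
      xs \<noteq> [] \<and> (if hd xs = 0 then (f, tl xs, y) \<in> set T
        else \<exists>E'\<in>set T. fst E' = c \<and> fst (snd E') = (hd xs - 1) # tl xs \<and>
          (g, snd (snd E') # (hd xs - 1) # tl xs, y) \<in> set T)
    else if tag = 5 then (a, y # xs, 0) \<in> set T \<and>
      (\<forall>j<y. \<exists>E'\<in>set T. fst E' = a \<and> fst (snd E') = j # xs \<and> snd (snd E') \<noteq> 0)
    else tag = 6 \<and> xs \<noteq> [] \<and> hd xs < s \<and> y = (if bit m (hd xs) then 1 else 0))"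

lemma rec_pred_justified:
  assumes "rec_fun X s" "rec_fun X m" "rec_fun X T" "rec_fun X E"
  shows "rec_pred X (\<lambda>a. justified (s a) (m a) (T a) (E a))"
proof -
  have "rec_pred X (\<lambda>z. justified (fst z) (fst (snd z)) (fst (snd (snd z))) (snd (snd (snd z))))"
    unfolding justified_def Let_def by (intro rec_intros)
  from rec_pred_comp[OF this, of "\<lambda>a. (s a, m a, T a, E a)"] show ?thesis
    using assms by (simp add: rec_fun_Pair)
qed

text \<open>The use principle: a step reads oracle bits only below \<open>s\<close>, and it asks for
  entries to be present in \<open>T\<close>, never absent.\<close>

lemma justified_mono:
  assumes "justified s m T E" "set T \<subseteq> set T'" "s \<le> s'" "\<And>i. i < s \<Longrightarrow> bit m' i = bit m i"
  shows "justified s' m' T' E"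
proof -
  have mem: "E' \<in> set T \<Longrightarrow> E' \<in> set T'" for E' using assms(2) by blast
  define tag where "tag = fst (dec (fst E) :: nat \<times> nat)"
  consider "tag = 0" | "tag = 1" | "tag = 2" | "tag = 3" | "tag = 4" | "tag = 5" | "tag > 5"
    by linarith
  then show ?thesis
  proof cases
    case 4
    then show ?thesis using assms(1) unfolding justified_def Let_def tag_def
      by (auto intro: mem bexI[OF _ mem])
  next
    case 5
    then show ?thesis using assms(1) unfolding justified_def Let_def tag_def
      by (auto split: if_splits intro: mem bexI[OF _ mem])
  next
    case 6
    then show ?thesis using assms(1) unfolding justified_def Let_def tag_def
      by (auto intro!: mem)
  qed (use assms(1,3,4) in \<open>auto simp: justified_def Let_def tag_def\<close>)
qed

text \<open>Conclusions come first: the premises of an entry stand behind it in the list.\<close>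

definition valid :: "nat \<Rightarrow> nat \<Rightarrow> entry list \<Rightarrow> bool" where
  "valid s m d \<longleftrightarrow> (\<forall>l<length d. justified s m (drop (Suc l) d) (hd (drop l d)))"

lemma valid_Nil [simp]: "valid s m []"
  by (simp add: valid_def)

lemma valid_Cons: "valid s m (E # T) \<longleftrightarrow> justified s m T E \<and> valid s m T"
  by (auto simp: valid_def All_less_Suc2)

lemma rec_pred_valid:
  assumes "rec_fun X s" "rec_fun X m" "rec_fun X d"
  shows "rec_pred X (\<lambda>a. valid (s a) (m a) (d a))"
proof -
  have "rec_pred X (\<lambda>z. valid (fst z) (fst (snd z)) (snd (snd z)))"
    unfolding valid_def by (intro rec_intros rec_pred_justified)
  from rec_pred_comp[OF this, of "\<lambda>a. (s a, m a, d a)"] show ?thesis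
    using assms by (simp add: rec_fun_Pair)
qed

lemma valid_mono:
  assumes "valid s m d" "s \<le> s'" "\<And>i. i < s \<Longrightarrow> bit m' i = bit m i"
  shows "valid s' m' d"
  using assms by (induction d) (auto simp: valid_Cons intro: justified_mono)

lemma valid_append: "valid s m d \<Longrightarrow> valid s m d' \<Longrightarrow> valid s m (d @ d')"
  by (induction d) (auto simp: valid_Cons elim!: justified_mono)

text \<open>The premises of an entry for \<open>r\<close> concern \<open>r\<close> itself or its
  subprograms, so numbers outside the range of \<open>rc\<close> never come up.\<close>

lemma justified_sound:
  assumes "justified s (pre X s) T (rc r, xs, y)"
    and T: "\<And>r xs y. (rc r, xs, y) \<in> set T \<Longrightarrow> eval X r xs y"
  shows "eval X r xs y"
proof (cases r)
  case Zero
  then show ?thesis using assms(1) by (simp add: justified_def ev_zero)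
next
  case Succ
  then show ?thesis using assms(1) by (cases xs) (simp_all add: justified_def ev_succ)
next
  case (Proj i)
  then show ?thesis using assms(1) by (simp add: justified_def eval_Proj hd_drop_conv_nth)
next
  case (Comp f gs)
  then obtain ys where "(rc f, ys, y) \<in> set T" "length ys = length gs"
    and gs: "\<And>j. j < length gs \<Longrightarrow> (rc (gs ! j), xs, ys ! j) \<in> set T"
    using assms(1) by (auto simp: justified_def hd_drop_conv_nth)
  with T show ?thesis unfolding Comp by (intro ev_comp) (auto simp: list_all2_conv_all_nth)
next
  case (Prim f g)
  then obtain n ys where xs: "xs = n # ys" using assms(1) by (cases xs) (auto simp: justified_def)
  show ?thesis
  proof (cases n)
    case 0
    then show ?thesis using assms(1) T unfolding Prim xs
      by (auto simp: justified_def intro: ev_prim0)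
  next
    case (Suc k)
    then obtain w where "(rc (Prim f g), k # ys, w) \<in> set T" "(rc g, w # k # ys, y) \<in> set T"
      using assms(1) unfolding Prim xs by (auto simp: justified_def)
    with T show ?thesis unfolding Prim xs Suc by (intro ev_primS) auto
  qed
next
  case (Mn f)
  then have "(rc f, y # xs, 0) \<in> set T"
    and *: "\<forall>j<y. \<exists>w. (rc f, j # xs, w) \<in> set T \<and> w \<noteq> 0"
    using assms(1) by (auto simp: justified_def Let_def) (metis prod.collapse)
  moreover have "\<forall>j<y. \<exists>w. eval X f (j # xs) (Suc w)"
    using * T by (metis not0_implies_Suc)
  ultimately show ?thesis unfolding Mn using T by (intro ev_mn) auto
next
  case Orc
  then obtain n ys where xs: "xs = n # ys" using assms(1) by (cases xs) (auto simp: justified_def)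
  then have "y = (if n \<in> X then 1 else 0)" using assms(1) Orc by (auto simp: justified_def)
  then show ?thesis unfolding Orc xs using ev_orc by blast
qed

lemma valid_sound:
  assumes "valid s (pre X s) d" "(rc r, xs, y) \<in> set d"
  shows "eval X r xs y"
  using assms
proof (induction d arbitrary: r xs y)
  case (Cons E d)
  then show ?case by (auto simp: valid_Cons intro: justified_sound)
qed simp

definition derivable :: "nat set \<Rightarrow> entry \<Rightarrow> bool" where
  "derivable X E \<longleftrightarrow> (\<exists>d s. valid s (pre X s) d \<and> E \<in> set d)"

text \<open>All oracle lengths are raised to their maximum, after which the derivations can be
  concatenated.\<close>

lemma derivable_finite:
  assumes "finite F" "\<And>E. E \<in> F \<Longrightarrow> derivable X E"
  shows "\<exists>d s. valid s (pre X s) d \<and> F \<subseteq> set d"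
  using assms
proof (induction F rule: finite_induct)
  case empty
  show ?case by (rule exI[of _ "[]"]) simp
next
  case (insert E F)
  then obtain d s d' s' where d: "valid s (pre X s) d" "F \<subseteq> set d" "valid s' (pre X s') d'" "E \<in> set d'"
    unfolding derivable_def by (metis insert_iff)
  let ?t = "max s s'"
  have "valid ?t (pre X ?t) d" "valid ?t (pre X ?t) d'"
    using d by (auto elim!: valid_mono)
  then have "valid ?t (pre X ?t) (d @ d')" by (rule valid_append)
  moreover have "insert E F \<subseteq> set (d @ d')" using d by auto
  ultimately show ?case by blast
qed

text \<open>One rule for all cases of \<open>eval\<close>: \<open>F\<close> collects the premises,
  and \<open>s0\<close> makes the oracle segment long enough for a query.\<close>

lemma derivableI:
  assumes "finite F" "\<And>E'. E' \<in> F \<Longrightarrow> derivable X E'"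
    and "\<And>T s. F \<subseteq> set T \<Longrightarrow> s0 \<le> s \<Longrightarrow> justified s (pre X s) T E"
  shows "derivable X E"
proof -
  obtain d s where d: "valid s (pre X s) d" "F \<subseteq> set d"
    using derivable_finite[OF assms(1,2)] by blast
  let ?t = "max s s0"
  have "valid ?t (pre X ?t) d"
    using d by (auto elim!: valid_mono)
  with d assms(3) have "valid ?t (pre X ?t) (E # d)" by (simp add: valid_Cons)
  then show ?thesis unfolding derivable_def by (metis list.set_intros(1))
qed

lemma eval_derivable: "eval X r xs y \<Longrightarrow> derivable X (rc r, xs, y)"
proof (induction rule: eval.induct)
  case (ev_zero xs)
  show ?case by (rule derivableI[of "{}"]) (auto simp: justified_def)
next
  case (ev_succ x xs)
  show ?case by (rule derivableI[of "{}"]) (auto simp: justified_def)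
next
  case (ev_proj i xs)
  then show ?case
    by (rule_tac derivableI[of "{}"]) (auto simp: justified_def hd_drop_conv_nth)
next
  case (ev_comp xs gs ys f z)
  then have len: "length ys = length gs"
    and gs: "\<And>j. j < length gs \<Longrightarrow> derivable X (rc (gs ! j), xs, ys ! j)"
    by (auto simp: list_all2_conv_all_nth)
  show ?case
  proof (rule derivableI)
    show "finite (insert (rc f, ys, z) ((\<lambda>j. (rc (gs ! j), xs, ys ! j)) ` {..<length gs}))"
      by simp
    show "derivable X E'" if "E' \<in> insert (rc f, ys, z) ((\<lambda>j. (rc (gs ! j), xs, ys ! j)) ` {..<length gs})" for E'
      using that ev_comp gs by auto
    show "justified s (pre X s) T (rc (Comp f gs), xs, z)"
      if "insert (rc f, ys, z) ((\<lambda>j. (rc (gs ! j), xs, ys ! j)) ` {..<length gs}) \<subseteq> set T" for T s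
    proof -
      have "(rc f, ys, z) \<in> set T" using that by simp
      moreover have "\<forall>j<length gs. (hd (drop j (map rc gs)), xs, hd (drop j ys)) \<in> set T"
        using that len by (simp add: hd_drop_conv_nth image_subset_iff)
      ultimately show ?thesis using len
        by (simp add: justified_def) (rule bexI[of _ "(rc f, ys, z)"], simp_all)
    qed
  qed
next
  case (ev_prim0 f xs y g)
  then show ?case
    by (rule_tac derivableI[of "{(rc f, xs, y)}"]) (auto simp: justified_def)
next
  case (ev_primS f g n xs y z)
  then show ?case
    by (rule_tac derivableI[of "{(rc (Prim f g), n # xs, y), (rc g, y # n # xs, z)}"])
      (auto simp: justified_def intro!: bexI[of _ "(rc (Prim f g), n # xs, y)"])
next
  case (ev_mn f n xs)
  then have "\<forall>m. \<exists>w. m < n \<longrightarrow> derivable X (rc f, m # xs, Suc w)"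
    by blast
  then obtain w where w: "\<And>m. m < n \<Longrightarrow> derivable X (rc f, m # xs, Suc (w m))"
    by metis
  show ?case
  proof (rule derivableI)
    show "finite (insert (rc f, n # xs, 0) ((\<lambda>m. (rc f, m # xs, Suc (w m))) ` {..<n}))"
      by simp
    show "derivable X E'" if "E' \<in> insert (rc f, n # xs, 0) ((\<lambda>m. (rc f, m # xs, Suc (w m))) ` {..<n})" for E'
      using that ev_mn w by auto
    show "justified s (pre X s) T (rc (Mn f), xs, n)"
      if "insert (rc f, n # xs, 0) ((\<lambda>m. (rc f, m # xs, Suc (w m))) ` {..<n}) \<subseteq> set T" for T s
    proof -
      have "\<exists>E'\<in>set T. fst E' = rc f \<and> fst (snd E') = j # xs \<and> snd (snd E') \<noteq> 0" if "j < n" for j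
        by (rule bexI[of _ "(rc f, j # xs, Suc (w j))"])
          (use that \<open>insert _ _ \<subseteq> set T\<close> in auto)
      then show ?thesis using that by (simp add: justified_def Let_def)
    qed
  qed
next
  case (ev_orc x xs)
  show ?case by (rule derivableI[of "{}" _ "Suc x"]) (auto simp: justified_def)
qed

text \<open>\<open>halts0 e s m x\<close>: the program \<open>e\<close> outputs \<open>0\<close> on \<open>x\<close>, as verified in \<open>s\<close> steps from the
  \<open>s\<close> oracle bits \<open>m\<close>.\<close>

definition halts0 :: "nat \<Rightarrow> nat \<Rightarrow> nat \<Rightarrow> nat \<Rightarrow> bool" where
  "halts0 e s m x \<longleftrightarrow> (\<exists>d<s. valid s m (dec d) \<and> (e, [x], 0) \<in> set (dec d :: entry list))"

lemma rec_pred_halts0: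
  assumes "rec_fun X e" "rec_fun X s" "rec_fun X m" "rec_fun X x"
  shows "rec_pred X (\<lambda>a. halts0 (e a) (s a) (m a) (x a))"
proof -
  have "rec_pred X (\<lambda>z. halts0 (fst z) (fst (snd z)) (fst (snd (snd z))) (snd (snd (snd z))))"
    unfolding halts0_def by (intro rec_intros rec_pred_valid)
  from rec_pred_comp[OF this, of "\<lambda>a. (e a, s a, m a, x a)"] show ?thesis
    using assms by (simp add: rec_fun_Pair)
qed

lemma halts0_mono:
  assumes "halts0 e s (m mod 2 ^ s) x" "s \<le> s'"
  shows "halts0 e s' m x"
proof -
  obtain d where d: "d < s" "valid s (m mod 2 ^ s) (dec d)" "(e, [x], 0) \<in> set (dec d :: entry list)"
    using assms(1) unfolding halts0_def by blast
  have "valid s' m (dec d)"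
    by (rule valid_mono[OF d(2) assms(2)]) (simp add: bit_mod_power)
  with d assms(2) show ?thesis unfolding halts0_def by (intro exI[of _ d]) auto
qed

lemma halts0_sound: "halts0 (rc r) s (pre X s) x \<Longrightarrow> eval X r [x] 0"
  unfolding halts0_def by (blast intro: valid_sound)

lemma halts0_complete:
  assumes "eval X r [x] 0"
  shows "\<exists>s. halts0 (rc r) s (pre X s) x"
proof -
  obtain d s where d: "valid s (pre X s) d" "(rc r, [x], 0) \<in> set d"
    using eval_derivable[OF assms] unfolding derivable_def by blast
  let ?t = "max s (Suc (enc d))"
  have "valid ?t (pre X ?t) d"
    using d by (auto elim!: valid_mono)
  with d have "halts0 (rc r) ?t (pre X ?t) x"
    unfolding halts0_def by (intro exI[of _ "enc d"]) auto
  then show ?thesis ..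
qed

text \<open>The stage \<open>s\<close> approximation to the c.e. set with index \<open>e\<close>,
  namely the domain of a program. The oracle is empty, hence the bits \<open>0\<close>.\<close>

definition enum :: "nat \<Rightarrow> nat \<Rightarrow> nat \<Rightarrow> bool" where
  "enum e s x \<longleftrightarrow> (\<exists>d<s. valid s 0 (dec d) \<and> (\<exists>E\<in>set (dec d :: entry list). fst E = e \<and> fst (snd E) = [x]))"

lemma rec_pred_enum:
  assumes "rec_fun X e" "rec_fun X s" "rec_fun X x"
  shows "rec_pred X (\<lambda>a. enum (e a) (s a) (x a))"
proof -
  have "rec_pred X (\<lambda>z. enum (fst z) (fst (snd z)) (snd (snd z)))"
    unfolding enum_def by (intro rec_intros rec_pred_valid)
  from rec_pred_comp[OF this, of "\<lambda>a. (e a, s a, x a)"] show ?thesis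
    using assms by (simp add: rec_fun_Pair)
qed

lemma enum_mono: "enum e s x \<Longrightarrow> s \<le> s' \<Longrightarrow> enum e s' x"
  unfolding enum_def by (meson less_le_trans valid_mono)

lemma ex_enum_iff: "(\<exists>s. enum (rc r) s x) \<longleftrightarrow> (\<exists>y. eval {} r [x] y)"
proof
  assume "\<exists>s. enum (rc r) s x"
  then obtain s d y where "valid s 0 d" "(rc r, [x], y) \<in> set d"
    unfolding enum_def by force
  then show "\<exists>y. eval {} r [x] y" using valid_sound[of s "{}" d] by auto
next
  assume "\<exists>y. eval {} r [x] y"
  then obtain y where "derivable {} (rc r, [x], y)" using eval_derivable by blast
  then obtain d s where d: "valid s 0 d" "(rc r, [x], y) \<in> set d"
    unfolding derivable_def by auto
  have "valid (max s (Suc (enc d))) 0 d"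
    using d by (auto elim!: valid_mono)
  with d have "enum (rc r) (max s (Suc (enc d))) x"
    unfolding enum_def by (intro exI[of _ "enc d"]) force
  then show "\<exists>s. enum (rc r) s x" ..
qed

lemma ce_enum: "ce D \<Longrightarrow> \<exists>e. \<forall>x. x \<in> D \<longleftrightarrow> (\<exists>s. enum e s x)"
  unfolding ce_def using ex_enum_iff by metis

lemma eval_det: "eval X r xs y \<Longrightarrow> eval X r xs z \<Longrightarrow> y = z"
proof (induction arbitrary: z rule: eval.induct)
  case (ev_comp xs gs ys f z')
  from ev_comp.prems obtain ys' where ys': "list_all2 (\<lambda>g. eval X g xs) gs ys'" "eval X f ys' z"
    by (cases rule: eval.cases) auto
  have "ys = ys'"
    using ev_comp.IH(1) ys'(1) by (auto simp: list_all2_conv_all_nth intro!: nth_equalityI)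
  with ys' ev_comp.IH(2) show ?case by blast
next
  case (ev_primS f g n xs y z')
  from ev_primS.prems obtain y' where "eval X (Prim f g) (n # xs) y'" "eval X g (y' # n # xs) z"
    by (cases rule: eval.cases) auto
  with ev_primS.IH show ?case by blast
next
  case (ev_mn f n xs)
  from ev_mn.prems have z: "eval X f (z # xs) 0" "\<forall>m<z. \<exists>y. eval X f (m # xs) (Suc y)"
    by (auto elim: eval.cases)
  show ?case
  proof (rule linorder_cases[of n z])
    assume "n < z"
    with z(2) ev_mn.IH(1) show ?thesis by fastforce
  next
    assume "z < n"
    with z(1) ev_mn.IH(2) show ?thesis by fastforce
  qed
qed (erule eval.cases; auto)+

lemma turing_le_iff: "A \<le>\<^sub>T B \<longleftrightarrow> rec_pred B (\<lambda>x. x \<in> A)"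
  by (simp add: turing_le_def rec_pred_def rec_fun_def)

text \<open>The set is the domain of the unbounded search for a witness \<open>w\<close>.\<close>

lemma ce_ex:
  assumes "rec_pred {} (\<lambda>z. P (fst z) (snd z))"
  shows "ce {x :: nat. \<exists>w :: nat. P x w}"
proof -
  have "rec_fun {} (\<lambda>z. if P (fst z) (snd z) then 0 else 1 :: nat)"
    using assms by (rule rec_fun_if[OF _ rec_fun_const rec_fun_const])
  then obtain t where "\<And>z. eval {} t [enc z] (if P (fst z) (snd z) then 0 else 1)"
    unfolding rec_fun_def enc_nat by blast
  from this[of "(x, w)" for x w]
  have t: "\<And>x w. eval {} t [prod_encode (x, w)] (if P x w then 0 else 1)"
    by (simp add: enc_prod_def)
  obtain p where p: "\<And>a b. eval {} p [a, b] (prod_encode (a, b))" using ex_eval_pair by blast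
  define r where "r = Comp t [Comp p [Proj 1, Proj 0]]"
  have r: "eval {} r [w, x] (if P x w then 0 else 1)" for x w
    unfolding r_def by (rule eval_Comp2 eval_Comp1 eval_Proj p | simp add: t del: prod_encode_eq)+
  have "(\<exists>w. P x w) \<longleftrightarrow> (\<exists>y. eval {} (Mn r) [x] y)" for x
  proof
    assume "\<exists>w. P x w"
    then have "\<exists>w. (if P x w then 0 else 1 :: nat) = 0" by auto
    from eval_Mn_Least[OF r this] show "\<exists>y. eval {} (Mn r) [x] y" by blast
  next
    assume "\<exists>y. eval {} (Mn r) [x] y"
    then obtain y where "eval {} (Mn r) [x] y" by blast
    then have "eval {} r [y, x] 0" by cases auto
    from eval_det[OF this r[of y x]] show "\<exists>w. P x w" by (auto split: if_splits)
  qed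
  then show ?thesis unfolding ce_def by blast
qed

section \<open>Measure and randomness\<close>

definition bits :: "nat \<Rightarrow> nat \<Rightarrow> bool list" where
  "bits k m = map (bit m) [0..<k]"

lemma length_bits [simp]: "length (bits k m) = k"
  by (simp add: bits_def)

lemma nth_bits [simp]: "i < k \<Longrightarrow> bits k m ! i = bit m i"
  by (simp add: bits_def)

lemma bits_Suc: "bits (Suc k) m = odd m # bits k (m div 2)"
  unfolding bits_def upt_conv_Cons[OF zero_less_Suc] map_Suc_upt[symmetric]
  by (simp add: bit_0 bit_Suc comp_def)

text \<open>\<open>str_code\<close> is bijective base-two numeration, which shifts the binary value
  of a string of length \<open>k\<close> by \<open>2 ^ k - 1\<close>.\<close>

lemma str_code_bits: "str_code (bits k m) = m mod 2 ^ k + (2 ^ k - 1)"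
proof (induction k arbitrary: m)
  case 0
  show ?case by (simp add: bits_def)
next
  case (Suc k)
  obtain c where c: "(2 :: nat) ^ k = Suc c" by (cases "(2 :: nat) ^ k") auto
  have "m mod 2 ^ Suc k = 2 * (m div 2 mod 2 ^ k) + m mod 2"
    using mod_mult2_eq[of m 2 "2 ^ k"] by simp
  with c show ?case
    by (auto simp: bits_Suc Suc odd_iff_mod_2_eq_one)
qed

lemma str_code_inj: "str_code \<sigma> = str_code \<tau> \<Longrightarrow> \<sigma> = \<tau>"
proof (induction \<sigma> arbitrary: \<tau>)
  case Nil
  then show ?case by (cases \<tau>) (auto split: if_splits)
next
  case (Cons b \<sigma>)
  then obtain c \<tau>' where \<tau>: "\<tau> = c # \<tau>'" by (cases \<tau>) (auto split: if_splits)
  with Cons.prems have "2 * str_code \<sigma> + (if b then 2 else 1) = 2 * str_code \<tau>' + (if c then 2 else 1)"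
    by simp
  then have "b = c \<and> str_code \<sigma> = str_code \<tau>'" by (auto split: if_splits; presburger)
  with Cons.IH \<tau> show ?case by auto
qed

lemma prefix_bits: "k \<le> t \<Longrightarrow> prefix (bits k m) (bits t m)"
  by (metis add_0 bits_def take_is_prefix take_map take_upt)

lemma inj_on_bits: "inj_on (bits t) {m. m < 2 ^ t}"
proof (rule inj_onI)
  fix m m' assume m: "m \<in> {m. m < 2 ^ t}" "m' \<in> {m. m < 2 ^ t}" and "bits t m = bits t m'"
  then have "str_code (bits t m) = str_code (bits t m')" by simp
  with m show "m = m'" unfolding str_code_bits by simp
qed

lemma extends_iff: "extends Y \<sigma> \<longleftrightarrow> \<sigma> = bits (length \<sigma>) (pre Y (length \<sigma>))"
  unfolding extends_def list_eq_iff_nth_eq by simp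

lemma finite_strings: "finite {\<sigma> :: bool list. length \<sigma> = k \<and> P \<sigma>}"
  by (rule finite_subset[OF _ finite_lists_length_eq[of "UNIV :: bool set" k]]) auto

lemma card_strings: "card {\<sigma> :: bool list. length \<sigma> = k \<and> P \<sigma>} \<le> 2 ^ k"
proof -
  have "card {\<sigma> :: bool list. length \<sigma> = k \<and> P \<sigma>} \<le> card {\<sigma> :: bool list. set \<sigma> \<subseteq> UNIV \<and> length \<sigma> = k}"
    by (intro card_mono finite_lists_length_eq) auto
  also have "\<dots> = 2 ^ k" by (subst card_lists_length_eq) (simp_all add: card_UNIV_bool)
  finally show ?thesis .
qed

lemma card_le_open_measure:
  "real (card {\<sigma>. length \<sigma> = k \<and> (\<exists>\<tau>\<in>S. prefix \<tau> \<sigma>)}) / 2 ^ k \<le> open_measure S"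
proof -
  have "bdd_above (range (\<lambda>k. real (card {\<sigma>. length \<sigma> = k \<and> (\<exists>\<tau>\<in>S. prefix \<tau> \<sigma>)}) / 2 ^ k))"
  proof (rule bdd_aboveI2)
    fix k
    have "real (card {\<sigma>. length \<sigma> = k \<and> (\<exists>\<tau>\<in>S. prefix \<tau> \<sigma>)}) \<le> real (2 ^ k)"
      by (intro of_nat_mono card_strings)
    then show "real (card {\<sigma>. length \<sigma> = k \<and> (\<exists>\<tau>\<in>S. prefix \<tau> \<sigma>)}) / 2 ^ k \<le> 1"
      by simp
  qed
  then show ?thesis unfolding open_measure_def by (intro cSUP_upper) auto
qed

text \<open>The universal test takes the component \<open>e + 2\<close> of the \<open>e\<close>-th c.e. set, and only at those stages at
  which its measure is at most \<open>2 ^ - (e + 2)\<close>. So it never covers all strings, whatever \<open>e\<close> enumerates.\<close>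

definition cov :: "nat \<Rightarrow> nat \<Rightarrow> nat \<Rightarrow> bool" where
  "cov e t m \<longleftrightarrow> (\<exists>k<Suc t. enum e t (enc (e + 2, m mod 2 ^ k + (2 ^ k - 1))))"

definition small :: "nat \<Rightarrow> nat \<Rightarrow> bool" where
  "small e t \<longleftrightarrow> length (sel (cov e t) (2 ^ t)) * 2 ^ (e + 2) \<le> 2 ^ t"

definition null :: "nat \<Rightarrow> nat \<Rightarrow> bool" where
  "null s m \<longleftrightarrow> (\<exists>e<s. \<exists>t<Suc s. small e t \<and> cov e t m)"

lemma rec_pred_cov:
  assumes "rec_fun X e" "rec_fun X t" "rec_fun X m"
  shows "rec_pred X (\<lambda>a. cov (e a) (t a) (m a))"
proof -
  have "rec_pred X (\<lambda>z. cov (fst z) (fst (snd z)) (snd (snd z)))"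
    unfolding cov_def by (intro rec_intros rec_pred_enum)
  from rec_pred_comp[OF this, of "\<lambda>a. (e a, t a, m a)"] show ?thesis
    using assms by (simp add: rec_fun_Pair)
qed

lemma rec_pred_null:
  assumes "rec_fun X s" "rec_fun X m"
  shows "rec_pred X (\<lambda>a. null (s a) (m a))"
proof -
  have "rec_pred X (\<lambda>z. null (fst z) (snd z))"
    unfolding null_def small_def by (intro rec_intros rec_pred_cov)
  from rec_pred_comp[OF this, of "\<lambda>a. (s a, m a)"] show ?thesis
    using assms by (simp add: rec_fun_Pair)
qed

lemma cov_mono: "cov e t m \<Longrightarrow> t \<le> t' \<Longrightarrow> cov e t' m"
proof -
  assume "cov e t m" and t: "t \<le> t'"
  then obtain k where "k < Suc t" "enum e t (enc (e + 2, m mod 2 ^ k + (2 ^ k - 1)))"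
    unfolding cov_def by blast
  with enum_mono[OF this(2) t] t show "cov e t' m"
    unfolding cov_def by (intro exI[of _ k]) simp
qed

lemma cov_mod: "t \<le> s \<Longrightarrow> cov e t (m mod 2 ^ s) \<longleftrightarrow> cov e t m"
  unfolding cov_def by (intro ex_cong1) (auto simp: mod_mod_power less_Suc_eq_le)

lemma null_mono: "null s (m mod 2 ^ s) \<Longrightarrow> s \<le> s' \<Longrightarrow> null s' m"
proof -
  assume "null s (m mod 2 ^ s)" "s \<le> s'"
  then obtain e t where "e < s" "t < Suc s" "small e t" "cov e t m"
    unfolding null_def by (auto simp: cov_mod)
  with \<open>s \<le> s'\<close> show "null s' m"
    unfolding null_def by (intro exI[of _ e] conjI exI[of _ t]) auto
qed

lemma card_mod_le:
  fixes P :: "nat \<Rightarrow> bool"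
  assumes "t \<le> s"
  shows "card {m. m < 2 ^ s \<and> P (m mod 2 ^ t)} \<le> card {m. m < 2 ^ t \<and> P m} * 2 ^ (s - t)"
proof -
  have "card {m :: nat. m < 2 ^ s \<and> P (m mod 2 ^ t)} \<le> card ({m :: nat. m < 2 ^ t \<and> P m} \<times> {..<2 ^ (s - t) :: nat})"
  proof (rule card_inj_on_le)
    show "inj_on (\<lambda>m. (m mod 2 ^ t, m div 2 ^ t)) {m :: nat. m < 2 ^ s \<and> P (m mod 2 ^ t)}"
      by (rule inj_onI) (metis div_mult_mod_eq prod.inject)
    show "(\<lambda>m. (m mod 2 ^ t, m div 2 ^ t)) ` {m :: nat. m < 2 ^ s \<and> P (m mod 2 ^ t)}
      \<subseteq> {m. m < 2 ^ t \<and> P m} \<times> {..<2 ^ (s - t)}"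
      using assms by (auto simp: less_mult_imp_div_less simp flip: power_add)
  qed auto
  then show ?thesis by (simp add: card_cartesian_product)
qed

text \<open>\<open>cov e\<close> grows with the stage, so everything is already covered at the last
  stage \<open>u\<close> that passes the measure check, where the covered part is small.\<close>

lemma card_small_le:
  "real (card {m. m < 2 ^ s \<and> (\<exists>t<Suc s. small e t \<and> cov e t m)}) \<le> 2 ^ s * (1/2) ^ (e + 2)"
proof (cases "\<exists>t<Suc s. small e t")
  case False
  then have empty: "{m. m < 2 ^ s \<and> (\<exists>t<Suc s. small e t \<and> cov e t m)} = {}" by blast
  show ?thesis unfolding empty by simp
next
  case True
  define u where "u = Max {t. t < Suc s \<and> small e t}"
  have u: "u < Suc s" "small e u"
    using Max_in[of "{t. t < Suc s \<and> small e t}"] True unfolding u_def by auto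
  have max: "t \<le> u" if "t < Suc s" "small e t" for t
    unfolding u_def using that by (intro Max_ge) auto
  have "{m. m < 2 ^ s \<and> (\<exists>t<Suc s. small e t \<and> cov e t m)} \<subseteq> {m. m < 2 ^ s \<and> cov e u (m mod 2 ^ u)}"
    using max by (auto simp: cov_mod intro: cov_mono)
  then have "card {m. m < 2 ^ s \<and> (\<exists>t<Suc s. small e t \<and> cov e t m)}
      \<le> card {m. m < 2 ^ s \<and> cov e u (m mod 2 ^ u)}"
    by (intro card_mono) auto
  also have "\<dots> \<le> card {m. m < 2 ^ u \<and> cov e u m} * 2 ^ (s - u)"
    using u by (intro card_mod_le) simp
  finally have "card {m. m < 2 ^ s \<and> (\<exists>t<Suc s. small e t \<and> cov e t m)} * 2 ^ (e + 2)
      \<le> card {m. m < 2 ^ u \<and> cov e u m} * 2 ^ (e + 2) * 2 ^ (s - u)"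
    by (simp add: mult.commute mult.left_commute)
  also have "\<dots> \<le> 2 ^ u * 2 ^ (s - u)"
    using u(2) unfolding small_def length_sel by (intro mult_right_mono) auto
  also have "\<dots> = 2 ^ s" using u by (simp flip: power_add)
  finally have "real (card {m. m < 2 ^ s \<and> (\<exists>t<Suc s. small e t \<and> cov e t m)} * 2 ^ (e + 2)) \<le> real (2 ^ s)"
    by (intro of_nat_mono)
  then show ?thesis by (simp add: field_simps power_one_over)
qed

text \<open>The rejected fractions are bounded by \<open>1/4 + 1/8 + ...\<close>, in total less than
  \<open>1/2\<close>, so some string survives.\<close>

lemma ex_not_null: "\<exists>m<2 ^ s. \<not> null s m"
proof (rule ccontr)
  assume "\<not> ?thesis"
  then have "{m. m < 2 ^ s} \<subseteq> (\<Union>e<s. {m. m < 2 ^ s \<and> (\<exists>t<Suc s. small e t \<and> cov e t m)})"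
    unfolding null_def by blast
  then have "card {m :: nat. m < 2 ^ s} \<le> card (\<Union>e<s. {m. m < 2 ^ s \<and> (\<exists>t<Suc s. small e t \<and> cov e t m)})"
    by (intro card_mono) auto
  also have "\<dots> \<le> (\<Sum>e<s. card {m. m < 2 ^ s \<and> (\<exists>t<Suc s. small e t \<and> cov e t m)})"
    by (rule card_UN_le) simp
  finally have "2 ^ s \<le> (\<Sum>e<s. card {m. m < 2 ^ s \<and> (\<exists>t<Suc s. small e t \<and> cov e t m)})"
    by simp
  then have "real (2 ^ s) \<le> real (\<Sum>e<s. card {m. m < 2 ^ s \<and> (\<exists>t<Suc s. small e t \<and> cov e t m)})"
    by (rule of_nat_mono)
  also have "\<dots> \<le> (\<Sum>e<s. 2 ^ s * (1/2) ^ (e + 2))"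
    unfolding of_nat_sum by (intro sum_mono card_small_le)
  also have "\<dots> = 2 ^ s * (\<Sum>e<s. (1/2) ^ (e + 2))" by (simp add: sum_distrib_left)
  also have "(\<Sum>e<s. (1/2 :: real) ^ (e + 2)) = 1/2 - (1/2) ^ (s + 1)"
    by (induction s) (simp_all add: field_simps)
  also have "(2 :: real) ^ s * (1/2 - (1/2) ^ (s + 1)) < 2 ^ s * 1"
    by (intro mult_strict_left_mono) (auto intro: order_less_le_trans[of _ "1/2"])
  finally show False by simp
qed

text \<open>For a genuine test the measure check never fails, so its component \<open>e + 2\<close>
  goes completely into the universal test.\<close>

lemma ml_test_small:
  assumes "ml_test W" and e: "\<And>x. x \<in> W \<longleftrightarrow> (\<exists>s. enum e s x)"
  shows "small e t"
proof -
  let ?S = "component W (e + 2)"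
  have "bits t ` {m. m < 2 ^ t \<and> cov e t m} \<subseteq> {\<sigma>. length \<sigma> = t \<and> (\<exists>\<tau>\<in>?S. prefix \<tau> \<sigma>)}"
  proof clarsimp
    fix m assume "cov e t m"
    then obtain k where k: "k < Suc t" "enum e t (prod_encode (e + 2, str_code (bits k m)))"
      unfolding cov_def by (auto simp: enc_prod_def str_code_bits)
    then have "bits k m \<in> ?S" using e unfolding component_def by auto
    then show "\<exists>\<tau>\<in>component W (Suc (Suc e)). prefix \<tau> (bits t m)"
      using k(1) prefix_bits[of k t m] by auto
  qed
  moreover have "inj_on (bits t) {m. m < 2 ^ t \<and> cov e t m}"
    by (rule inj_on_subset[OF inj_on_bits]) auto
  ultimately have "card {m. m < 2 ^ t \<and> cov e t m} \<le> card {\<sigma>. length \<sigma> = t \<and> (\<exists>\<tau>\<in>?S. prefix \<tau> \<sigma>)}"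
    by (intro card_inj_on_le finite_strings)
  then have "real (card {m. m < 2 ^ t \<and> cov e t m}) / 2 ^ t
      \<le> real (card {\<sigma>. length \<sigma> = t \<and> (\<exists>\<tau>\<in>?S. prefix \<tau> \<sigma>)}) / 2 ^ t"
    by (simp add: divide_right_mono)
  also have "\<dots> \<le> open_measure ?S" by (rule card_le_open_measure)
  also have "\<dots> \<le> 1 / 2 ^ (e + 2)" using assms(1) unfolding ml_test_def by blast
  finally have "real (card {m. m < 2 ^ t \<and> cov e t m} * 2 ^ (e + 2)) \<le> real (2 ^ t)"
    by (simp add: field_simps)
  then show ?thesis unfolding small_def length_sel by (simp only: of_nat_le_iff)
qed

lemma not_null_ml_random:
  assumes "\<And>s. \<not> null s (pre Y s)"
  shows "ml_random Y"
  unfolding ml_random_def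
proof (intro allI impI notI)
  fix W assume W: "ml_test W" and "\<forall>n. \<exists>\<sigma>\<in>component W n. extends Y \<sigma>"
  obtain e where e: "\<And>x. x \<in> W \<longleftrightarrow> (\<exists>s. enum e s x)"
    using W ce_enum unfolding ml_test_def by blast
  obtain \<sigma> where \<sigma>: "\<sigma> \<in> component W (e + 2)" "extends Y \<sigma>"
    using \<open>\<forall>n. \<exists>\<sigma>\<in>component W n. extends Y \<sigma>\<close> by blast
  define k where "k = length \<sigma>"
  have "str_code \<sigma> = pre Y k + (2 ^ k - 1)"
    using \<sigma>(2) pre_less[of Y k] unfolding extends_iff k_def[symmetric] by (simp add: str_code_bits)
  then obtain s0 where s0: "enum e s0 (enc (e + 2, pre Y k + (2 ^ k - 1)))"
    using \<sigma>(1) e unfolding component_def by (auto simp: enc_prod_def)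
  \<comment> \<open>Late enough for the string to be enumerated and to fit into \<open>s\<close>
    bits, and for index \<open>e\<close> to be considered.\<close>
  define s where "s = Max {s0, k, Suc e}"
  have s: "s0 \<le> s" "k \<le> s" "e < s" unfolding s_def by auto
  have "cov e s (pre Y s)"
    unfolding cov_def using s enum_mono[OF s0] by (intro exI[of _ k]) (auto simp: pre_mod)
  moreover have "small e s" using W e by (rule ml_test_small)
  ultimately have "null s (pre Y s)" unfolding null_def using s by blast
  with assms show False by blast
qed

lemma card_strings_take: "card {\<sigma> :: bool list. length \<sigma> = k \<and> take l \<sigma> = u} \<le> 2 ^ (k - l)"
proof -
  have "card {\<sigma>. length \<sigma> = k \<and> take l \<sigma> = u} \<le> card {\<sigma> :: bool list. length \<sigma> = k - l \<and> True}"
  proof (rule card_inj_on_le)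
    show "inj_on (drop l) {\<sigma>. length \<sigma> = k \<and> take l \<sigma> = u}"
      by (rule inj_onI) (metis (mono_tags, lifting) append_take_drop_id mem_Collect_eq)
  qed (auto simp: finite_strings[of _ "\<lambda>_. True", simplified])
  also have "\<dots> \<le> 2 ^ (k - l)" by (rule card_strings)
  finally show ?thesis .
qed

text \<open>One string of each length above \<open>n\<close> contributes at most the tail of the
  geometric series after \<open>n\<close>.\<close>

lemma open_measure_le:
  assumes uniq: "\<And>\<sigma> \<tau>. \<sigma> \<in> S \<Longrightarrow> \<tau> \<in> S \<Longrightarrow> length \<sigma> = length \<tau> \<Longrightarrow> \<sigma> = \<tau>"
    and len: "\<And>\<sigma>. \<sigma> \<in> S \<Longrightarrow> n < length \<sigma>"
  shows "open_measure S \<le> 1 / 2 ^ n"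
  unfolding open_measure_def
proof (rule cSUP_least)
  fix k
  \<comment> \<open>For a length not occurring in \<open>S\<close> this is an arbitrary string,
    which can only increase the upper bound.\<close>
  define u where "u l = (THE \<sigma>. \<sigma> \<in> S \<and> length \<sigma> = l)" for l
  have u: "u (length \<sigma>) = \<sigma>" if "\<sigma> \<in> S" for \<sigma>
    unfolding u_def using that uniq by blast
  let ?A = "\<lambda>l. {\<sigma> :: bool list. length \<sigma> = k \<and> take l \<sigma> = u l}"
  have "{\<sigma>. length \<sigma> = k \<and> (\<exists>\<tau>\<in>S. prefix \<tau> \<sigma>)} \<subseteq> (\<Union>l\<in>{n<..k}. ?A l)"
  proof clarify
    fix \<sigma> \<tau> :: "bool list" assume "\<tau> \<in> S" "prefix \<tau> \<sigma>" "k = length \<sigma>"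
    then show "\<sigma> \<in> (\<Union>l\<in>{n<..length \<sigma>}. {\<sigma>'. length \<sigma>' = length \<sigma> \<and> take l \<sigma>' = u l})"
      using len[of \<tau>] u[of \<tau>] by (auto simp: prefix_def intro!: bexI[of _ "length \<tau>"])
  qed
  then have "card {\<sigma>. length \<sigma> = k \<and> (\<exists>\<tau>\<in>S. prefix \<tau> \<sigma>)} \<le> card (\<Union>l\<in>{n<..k}. ?A l)"
    by (intro card_mono) (auto intro: finite_strings)
  also have "\<dots> \<le> (\<Sum>l\<in>{n<..k}. card (?A l))" by (rule card_UN_le) simp
  also have "\<dots> \<le> (\<Sum>l\<in>{n<..k}. 2 ^ (k - l))" by (intro sum_mono card_strings_take)
  finally have "real (card {\<sigma>. length \<sigma> = k \<and> (\<exists>\<tau>\<in>S. prefix \<tau> \<sigma>)}) \<le> real (\<Sum>l\<in>{n<..k}. 2 ^ (k - l))"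
    by (rule of_nat_mono)
  also have "\<dots> = (\<Sum>l\<in>{n<..k}. 2 ^ k * (1/2) ^ l)"
    unfolding of_nat_sum of_nat_power
    by (rule sum.cong) (auto simp: power_diff power_one_over field_simps)
  also have "\<dots> = 2 ^ k * (\<Sum>l\<in>{n<..k}. (1/2) ^ l)" by (simp add: sum_distrib_left)
  also have "(\<Sum>l\<in>{n<..k}. (1/2 :: real) ^ l) \<le> (1/2) ^ n"
  proof (cases "n \<le> k")
    case True
    then have "(\<Sum>l\<in>{n<..k}. (1/2 :: real) ^ l) = (1/2) ^ n - (1/2) ^ k"
    proof (induction k rule: dec_induct)
      case (step k)
      then have "{n<..Suc k} = insert (Suc k) {n<..k}" by auto
      with step.IH show ?case by simp
    qed simp
    then show ?thesis by simp
  qed simp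
  finally show "real (card {\<sigma>. length \<sigma> = k \<and> (\<exists>\<tau>\<in>S. prefix \<tau> \<sigma>)}) / 2 ^ k \<le> 1 / 2 ^ n"
    by (simp add: field_simps power_one_over)
qed simp

text \<open>A random set avoids almost all members of a c.e. family of strings with at most one string of
  each length: the strings of length above \<open>n\<close> have measure at most \<open>2 ^ - n\<close>.\<close>

lemma ml_random_avoids:
  fixes R :: "nat \<Rightarrow> nat \<Rightarrow> nat \<Rightarrow> bool"
  assumes Y: "ml_random Y"
    and R: "rec_pred {} (\<lambda>z. R (fst z) (fst (snd z)) (snd (snd z)))"
    and uniq: "\<And>s s' l v v'. R s l v \<Longrightarrow> R s' l v' \<Longrightarrow> v = v'"
  shows "\<exists>N. \<forall>s l v. N \<le> l \<longrightarrow> R s l v \<longrightarrow> pre Y l \<noteq> v"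
proof -
  \<comment> \<open>\<open>x\<close> is read as a component index with a string code, and
    \<open>w\<close> as the triple \<open>(s, l, v)\<close> witnessing enumeration of that
    string.\<close>
  define P where "P x w \<longleftrightarrow> (let s = fst (dec w :: nat \<times> nat \<times> nat);
      l = fst (snd (dec w :: nat \<times> nat \<times> nat)); v = snd (snd (dec w :: nat \<times> nat \<times> nat)) in
    fst (dec x :: nat \<times> nat) < l \<and> snd (dec x :: nat \<times> nat) = v + (2 ^ l - 1) \<and> v < 2 ^ l \<and> R s l v)"
    for x w :: nat
  define W where "W = {x. \<exists>w. P x w}"
  have "rec_pred {} (\<lambda>z :: nat \<times> nat. R (fst (dec (snd z) :: nat \<times> nat \<times> nat))
      (fst (snd (dec (snd z) :: nat \<times> nat \<times> nat))) (snd (snd (dec (snd z) :: nat \<times> nat \<times> nat))))"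
    by (rule rec_pred_comp[OF R, of "\<lambda>z. dec (snd z)"]) (intro rec_intros)
  then have "ce W"
    unfolding W_def P_def Let_def by (intro ce_ex rec_intros)
  have P: "(\<exists>w. P (enc (n, c)) w) \<longleftrightarrow> (\<exists>s l v. n < l \<and> c = v + (2 ^ l - 1) \<and> v < 2 ^ l \<and> R s l v)"
    for n c :: nat
  proof
    assume "\<exists>s l v. n < l \<and> c = v + (2 ^ l - 1) \<and> v < 2 ^ l \<and> R s l v"
    then obtain s l v where "n < l \<and> c = v + (2 ^ l - 1) \<and> v < 2 ^ l \<and> R s l v" by blast
    then have "P (enc (n, c)) (enc (s, l, v))" unfolding P_def by simp
    then show "\<exists>w. P (enc (n, c)) w" ..
  qed (auto simp: P_def Let_def)
  have comp: "\<sigma> \<in> component W n \<longleftrightarrow> (\<exists>s l v. n < l \<and> \<sigma> = bits l v \<and> v < 2 ^ l \<and> R s l v)" for \<sigma> n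
  proof -
    have "\<sigma> \<in> component W n \<longleftrightarrow> (\<exists>w. P (enc (n, str_code \<sigma>)) w)"
      unfolding component_def W_def by (simp add: enc_prod_def)
    also have "\<dots> \<longleftrightarrow> (\<exists>s l v. n < l \<and> str_code \<sigma> = str_code (bits l v) \<and> v < 2 ^ l \<and> R s l v)"
      unfolding P by (intro ex_cong1) (auto simp: str_code_bits)
    also have "\<dots> \<longleftrightarrow> (\<exists>s l v. n < l \<and> \<sigma> = bits l v \<and> v < 2 ^ l \<and> R s l v)"
      using str_code_inj by blast
    finally show ?thesis .
  qed
  have "open_measure (component W n) \<le> 1 / 2 ^ n" for n
    by (rule open_measure_le) (auto simp: comp dest: uniq)
  with \<open>ce W\<close> have "ml_test W" unfolding ml_test_def by blast
  with Y obtain n where n: "\<And>\<sigma>. \<sigma> \<in> component W n \<Longrightarrow> \<not> extends Y \<sigma>"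
    unfolding ml_random_def by blast
  have "pre Y l \<noteq> v" if "Suc n \<le> l" "R s l v" for s l v
  proof
    assume v: "pre Y l = v"
    then have "bits l v \<in> component W n" using that pre_less[of Y l] unfolding comp
      by (intro exI[of _ s] exI[of _ l] exI[of _ v]) auto
    from n[OF this] v show False unfolding extends_iff by simp
  qed
  then show ?thesis by blast
qed

section \<open>The construction\<close>

text \<open>A condition is a list of entries, the newest first. The entry \<open>(t, f)\<close> above the tail \<open>q\<close>
  concerns the requirement that the program \<open>length q div 2\<close> does not compute \<open>C\<^sub>i\<close> from \<open>Y\<^sub>i\<close>, where
  \<open>i = length q mod 2\<close>: it demands that this program does not output \<open>0\<close> on \<open>f - 1\<close> from \<open>Y\<^sub>i\<close>
  (nothing if \<open>f = 0\<close>), and that \<open>Y\<^sub>1\<^sub>-\<^sub>i\<close> has the initial segment \<open>t\<close> of length \<open>enc q + 1\<close>.\<close>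

type_synonym cond = "(nat \<times> nat) list"

text \<open>Here \<open>m\<close> is a candidate segment for the random set number \<open>i\<close>.
  The demand on its initial segment is waived while \<open>m\<close> is too short, so that
  truncation preserves the property.\<close>

definition meets :: "nat \<Rightarrow> nat \<Rightarrow> nat \<Rightarrow> cond \<Rightarrow> bool" where
  "meets i s m p \<longleftrightarrow> (if length (tl p) mod 2 = i
    then snd (hd p) = 0 \<or> \<not> halts0 (length (tl p) div 2) s m (snd (hd p) - 1)
    else Suc (enc (tl p)) \<le> s \<longrightarrow> m mod 2 ^ Suc (enc (tl p)) = fst (hd p))"

text \<open>Level \<open>s\<close> of the tree whose paths are the Pi^0_1 class of candidates under
  the condition \<open>p\<close>.\<close>

definition alive :: "nat \<Rightarrow> nat \<Rightarrow> nat \<Rightarrow> cond \<Rightarrow> bool" where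
  "alive i s m p \<longleftrightarrow> m < 2 ^ s \<and> \<not> null s m \<and> (\<forall>l<length p. meets i s m (drop l p))"

text \<open>Every number is a follower: it codes the condition it serves together with a counter, so
  each condition has infinitely many followers and shares none.\<close>

definition owner :: "nat \<Rightarrow> cond" where
  "owner x = fst (dec x :: cond \<times> nat)"

definition realized :: "nat \<Rightarrow> nat \<Rightarrow> bool" where
  "realized s x \<longleftrightarrow> (\<forall>m<2 ^ s. alive (length (owner x) mod 2) s m (owner x) \<longrightarrow>
    halts0 (length (owner x) div 2) s m x)"

text \<open>Choosing the least segment makes it nondecreasing in \<open>s\<close> from some stage
  on. The alternative \<open>2 ^ s \<le> v\<close> makes the search total.\<close>

definition segment :: "nat \<Rightarrow> cond \<Rightarrow> nat" where
  "segment s p = (LEAST v. 2 ^ s \<le> v \<or>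
    (\<exists>m<2 ^ s. alive (1 - length p mod 2) s m p \<and> m mod 2 ^ Suc (enc p) = v))"

text \<open>The value \<open>s\<close> signals that no unrealized follower has been found among the
  first \<open>s\<close>.\<close>

definition unrealized :: "nat \<Rightarrow> cond \<Rightarrow> nat" where
  "unrealized s p = (LEAST k. s \<le> k \<or> \<not> realized s (enc (p, k)))"

text \<open>The history \<open>h\<close> lists, for each past stage, the numbers that have been enumerated at it.\<close>

definition entered :: "nat list list \<Rightarrow> nat \<Rightarrow> bool" where
  "entered h x \<longleftrightarrow> (\<exists>l\<in>set h. x \<in> set l)"

definition acted :: "nat list list \<Rightarrow> cond \<Rightarrow> bool" where
  "acted h p \<longleftrightarrow> (\<exists>l\<in>set h. \<exists>x\<in>set l. owner x = p)"

definition extend :: "nat list list \<Rightarrow> nat \<Rightarrow> cond \<Rightarrow> cond" where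
  "extend h s p = (segment s p,
    if acted h p \<or> s \<le> unrealized s p then 0 else Suc (enc (p, unrealized s p))) # p"

definition path :: "nat list list \<Rightarrow> nat \<Rightarrow> nat \<Rightarrow> cond" where
  "path h s k = rec_nat [] (\<lambda>_ p. extend h s p) k"

text \<open>The minimum is a computable choice of a survivor. Convergence comes from the longer and
  longer segments that \<open>path\<close> prescribes.\<close>

definition approx :: "nat list list \<Rightarrow> nat \<Rightarrow> nat \<Rightarrow> nat" where
  "approx h s i = (LEAST m. 2 ^ s \<le> m \<or> alive i s m (path h s s))"

text \<open>A realized follower \<open>x\<close> is enumerated once \<open>D\<close> permits it, provided that the relevant initial
  segment of the other random set has been constant since stage \<open>x\<close>.\<close>

definition enters :: "nat \<Rightarrow> nat list list \<Rightarrow> nat \<Rightarrow> nat \<Rightarrow> bool" where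
  "enters e h s x \<longleftrightarrow> \<not> acted h (owner x) \<and> realized s x \<and>
    (\<exists>z<x. enum e (Suc s) z \<and> \<not> enum e s z) \<and>
    (\<forall>t<Suc s. x \<le> t \<longrightarrow>
      approx (drop (s - t) h) t (1 - length (owner x) mod 2) mod 2 ^ Suc (enc (owner x)) =
      approx h s (1 - length (owner x) mod 2) mod 2 ^ Suc (enc (owner x)))"

text \<open>Carrying the whole history turns the course-of-values recursion into a primitive
  recursion on the stage.\<close>

definition hist :: "nat \<Rightarrow> nat \<Rightarrow> nat list list" where
  "hist e s = rec_nat [] (\<lambda>s h. sel (\<lambda>x. enters e h s x) (Suc s) # h) s"

section \<open>Computability of the construction\<close>

lemma rec_pred_meets:
  assumes "rec_fun X i" "rec_fun X s" "rec_fun X m" "rec_fun X p"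
  shows "rec_pred X (\<lambda>a. meets (i a) (s a) (m a) (p a))"
proof -
  have "rec_pred X (\<lambda>z. meets (fst z) (fst (snd z)) (fst (snd (snd z))) (snd (snd (snd z))))"
    unfolding meets_def by (intro rec_intros rec_pred_halts0)
  from rec_pred_comp[OF this, of "\<lambda>a. (i a, s a, m a, p a)"] show ?thesis
    using assms by (simp add: rec_fun_Pair)
qed

lemma rec_pred_alive:
  assumes "rec_fun X i" "rec_fun X s" "rec_fun X m" "rec_fun X p"
  shows "rec_pred X (\<lambda>a. alive (i a) (s a) (m a) (p a))"
proof -
  have "rec_pred X (\<lambda>z. alive (fst z) (fst (snd z)) (fst (snd (snd z))) (snd (snd (snd z))))"
    unfolding alive_def by (intro rec_intros rec_pred_meets rec_pred_null)
  from rec_pred_comp[OF this, of "\<lambda>a. (i a, s a, m a, p a)"] show ?thesis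
    using assms by (simp add: rec_fun_Pair)
qed

lemma rec_fun_owner: "rec_fun X f \<Longrightarrow> rec_fun X (\<lambda>a. owner (f a))"
  unfolding owner_def by (intro rec_intros)

lemma rec_pred_realized:
  assumes "rec_fun X s" "rec_fun X x"
  shows "rec_pred X (\<lambda>a. realized (s a) (x a))"
proof -
  have "rec_pred X (\<lambda>z. realized (fst z) (snd z))"
    unfolding realized_def by (intro rec_intros rec_pred_alive rec_pred_halts0 rec_fun_owner)
  from rec_pred_comp[OF this, of "\<lambda>a. (s a, x a)"] show ?thesis
    using assms by (simp add: rec_fun_Pair)
qed

lemma rec_fun_segment:
  assumes "rec_fun X s" "rec_fun X p"
  shows "rec_fun X (\<lambda>a. segment (s a) (p a))"
proof -
  have "rec_fun X (\<lambda>z. segment (fst z) (snd z))"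
    unfolding segment_def by (rule rec_fun_Least) ((intro rec_intros rec_pred_alive), blast)
  from rec_fun_comp[OF this, of "\<lambda>a. (s a, p a)"] show ?thesis
    using assms by (simp add: rec_fun_Pair)
qed

lemma rec_fun_unrealized:
  assumes "rec_fun X s" "rec_fun X p"
  shows "rec_fun X (\<lambda>a. unrealized (s a) (p a))"
proof -
  have "rec_fun X (\<lambda>z. unrealized (fst z) (snd z))"
    unfolding unrealized_def by (rule rec_fun_Least) ((intro rec_intros rec_pred_realized), blast)
  from rec_fun_comp[OF this, of "\<lambda>a. (s a, p a)"] show ?thesis
    using assms by (simp add: rec_fun_Pair)
qed

lemma rec_pred_entered:
  "rec_fun X h \<Longrightarrow> rec_fun X x \<Longrightarrow> rec_pred X (\<lambda>a. entered (h a) (x a))"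
proof -
  assume hx: "rec_fun X h" "rec_fun X x"
  have "rec_pred X (\<lambda>z. entered (fst z) (snd z))"
    unfolding entered_def by (intro rec_intros)
  from rec_pred_comp[OF this, of "\<lambda>a. (h a, x a)"] show ?thesis
    using hx by (simp add: rec_fun_Pair)
qed

lemma rec_fun_extend:
  assumes "rec_fun X h" "rec_fun X s" "rec_fun X p"
  shows "rec_fun X (\<lambda>a. extend (h a) (s a) (p a))"
proof -
  have "rec_fun X (\<lambda>z. extend (fst z) (fst (snd z)) (snd (snd z)))"
    unfolding extend_def acted_def
    by (intro rec_intros rec_fun_segment rec_fun_unrealized rec_fun_owner)
  from rec_fun_comp[OF this, of "\<lambda>a. (h a, s a, p a)"] show ?thesis
    using assms by (simp add: rec_fun_Pair)
qed

lemma rec_fun_path: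
  assumes "rec_fun X h" "rec_fun X s" "rec_fun X k"
  shows "rec_fun X (\<lambda>a. path (h a) (s a) (k a))"
proof -
  have "rec_fun X (\<lambda>z. path (fst z) (fst (snd z)) (snd (snd z)))"
    unfolding path_def by (intro rec_fun_rec_nat rec_intros rec_fun_extend)
  from rec_fun_comp[OF this, of "\<lambda>a. (h a, s a, k a)"] show ?thesis
    using assms by (simp add: rec_fun_Pair)
qed

lemma rec_fun_approx:
  assumes "rec_fun X h" "rec_fun X s" "rec_fun X i"
  shows "rec_fun X (\<lambda>a. approx (h a) (s a) (i a))"
proof -
  have "rec_fun X (\<lambda>z. approx (fst z) (fst (snd z)) (snd (snd z)))"
    unfolding approx_def
    by (rule rec_fun_Least) ((intro rec_intros rec_pred_alive rec_fun_path), blast)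
  from rec_fun_comp[OF this, of "\<lambda>a. (h a, s a, i a)"] show ?thesis
    using assms by (simp add: rec_fun_Pair)
qed

lemma rec_pred_enters:
  assumes "rec_fun X h" "rec_fun X s" "rec_fun X x"
  shows "rec_pred X (\<lambda>a. enters e (h a) (s a) (x a))"
proof -
  have "rec_pred X (\<lambda>z. enters e (fst z) (fst (snd z)) (snd (snd z)))"
    unfolding enters_def acted_def
    by (intro rec_intros rec_pred_realized rec_pred_enum rec_fun_approx rec_fun_owner)
  from rec_pred_comp[OF this, of "\<lambda>a. (h a, s a, x a)"] show ?thesis
    using assms by (simp add: rec_fun_Pair)
qed

lemma rec_fun_hist: "rec_fun X s \<Longrightarrow> rec_fun X (\<lambda>a. hist e (s a))"
  unfolding hist_def by (intro rec_fun_rec_nat rec_intros rec_pred_enters)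

section \<open>Conditions and survivors at a fixed stage\<close>

lemma owner_enc [simp]: "owner (enc (p, k :: nat)) = p"
  by (simp add: owner_def)

lemma alive_Nil: "alive i s m [] \<longleftrightarrow> m < 2 ^ s \<and> \<not> null s m"
  by (simp add: alive_def)

lemma alive_Cons: "alive i s m (a # p) \<longleftrightarrow> meets i s m (a # p) \<and> alive i s m p"
  by (auto simp: alive_def All_less_Suc2)

lemma meets_mono:
  assumes "meets i s' m p" "s \<le> s'"
  shows "meets i s (m mod 2 ^ s) p"
  using assms halts0_mono[of _ s m _ s'] unfolding meets_def
  by (auto simp: mod_mod_power simp del: power_Suc split: if_splits)

text \<open>Rejections and halting computations persist, so truncating a survivor gives a survivor
  of the earlier stage.\<close>

lemma alive_mono: "alive i s' m p \<Longrightarrow> s \<le> s' \<Longrightarrow> alive i s (m mod 2 ^ s) p"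
  unfolding alive_def using meets_mono[of i s' m _ s] null_mono[of s m s'] by auto

lemma realized_mono: "realized s x \<Longrightarrow> s \<le> s' \<Longrightarrow> realized s' x"
  unfolding realized_def
proof (intro allI impI)
  fix m
  assume r: "\<forall>m<2 ^ s. alive (length (owner x) mod 2) s m (owner x) \<longrightarrow> halts0 (length (owner x) div 2) s m x"
    and s: "s \<le> s'" and "alive (length (owner x) mod 2) s' m (owner x)"
  then have "halts0 (length (owner x) div 2) s (m mod 2 ^ s) x"
    using alive_mono by (metis alive_def)
  then show "halts0 (length (owner x) div 2) s' m x" using s by (rule halts0_mono)
qed

lemma path_0 [simp]: "path h s 0 = []"
  by (simp add: path_def)

lemma path_Suc [simp]: "path h s (Suc k) = extend h s (path h s k)"
  by (simp add: path_def)

lemma length_path [simp]: "length (path h s k) = k"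
  by (induction k) (simp_all add: extend_def)

lemma segment_witness:
  assumes "alive (1 - length p mod 2) s m p"
  shows "\<exists>m'. alive (1 - length p mod 2) s m' p \<and> m' mod 2 ^ Suc (enc p) = segment s p"
proof -
  let ?Q = "\<lambda>v. 2 ^ s \<le> v \<or> (\<exists>m<2 ^ s. alive (1 - length p mod 2) s m p \<and> m mod 2 ^ Suc (enc p) = v)"
  have m: "m < 2 ^ s" using assms by (simp add: alive_def)
  then have "?Q (m mod 2 ^ Suc (enc p))" using assms by blast
  then have "segment s p \<le> m mod 2 ^ Suc (enc p)" and "?Q (segment s p)"
    unfolding segment_def by (rule Least_le, rule LeastI)
  moreover have "m mod 2 ^ Suc (enc p) < 2 ^ s"
    using m by (rule le_less_trans[OF mod_less_eq_dividend])
  ultimately show ?thesis by auto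
qed

text \<open>No entry empties the class: an unrealized follower has a survivor on which the program
  does not output 0, and a prescribed segment is taken from a survivor.\<close>

lemma ex_alive_path:
  assumes "i < 2"
  shows "\<exists>m. alive i s m (path h s k)"
proof (induction k)
  case 0
  then show ?case using ex_not_null by (auto simp: alive_Nil)
next
  case (Suc k)
  let ?p = "path h s k"
  show ?case
  proof (cases "k mod 2 = i")
    case True
    let ?j = "unrealized s ?p"
    obtain m where m: "alive i s m ?p"
      "\<not> acted h ?p \<Longrightarrow> ?j < s \<Longrightarrow> \<not> halts0 (k div 2) s m (enc (?p, ?j))"
    proof (cases "?j < s")
      case less: True
      have "s \<le> ?j \<or> \<not> realized s (enc (?p, ?j))"
        unfolding unrealized_def by (rule LeastI[of _ s]) simp
      with less True that show ?thesis unfolding realized_def by auto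
    next
      case False
      with Suc that show ?thesis by blast
    qed
    then have "alive i s m (extend h s ?p)"
      using True by (auto simp: extend_def alive_Cons meets_def)
    then show ?thesis by auto
  next
    case False
    then have i: "i = 1 - length ?p mod 2" using assms by auto
    with Suc obtain m where "alive i s m ?p" "m mod 2 ^ Suc (enc ?p) = segment s ?p"
      using segment_witness[of ?p s] by blast
    then have "alive i s m (extend h s ?p)"
      using False by (auto simp: extend_def alive_Cons meets_def simp del: power_Suc)
    then show ?thesis by auto
  qed
qed

lemma alive_path_le:
  assumes "alive i s m (path h s k)" "j \<le> k"
  shows "alive i s m (path h s j)"
  using assms(2,1) by (induction rule: dec_induct) (auto simp: extend_def alive_Cons)

lemma alive_approx:
  assumes "i < 2"
  shows "alive i s (approx h s i) (path h s s)"
proof -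
  obtain m where m: "alive i s m (path h s s)" using ex_alive_path[OF assms] by blast
  then have "2 ^ s \<le> m \<or> alive i s m (path h s s)" ..
  then have "approx h s i \<le> m" and "2 ^ s \<le> approx h s i \<or> alive i s (approx h s i) (path h s s)"
    unfolding approx_def by (rule Least_le, rule LeastI)
  moreover have "m < 2 ^ s" using m by (simp add: alive_def)
  ultimately show ?thesis by auto
qed

lemma approx_mod_segment:
  assumes "k < s" "Suc (enc (path h s k)) \<le> s"
  shows "approx h s (1 - k mod 2) mod 2 ^ Suc (enc (path h s k)) = segment s (path h s k)"
proof -
  have "alive (1 - k mod 2) s (approx h s (1 - k mod 2)) (path h s (Suc k))"
    using assms(1) by (intro alive_path_le[OF alive_approx]) auto
  moreover have "k mod 2 \<noteq> 1 - k mod 2" by presburger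
  ultimately show ?thesis
    using assms(2) by (auto simp: extend_def alive_Cons meets_def simp del: power_Suc)
qed

section \<open>The history along the stages\<close>

lemma hist_0 [simp]: "hist e 0 = []"
  by (simp add: hist_def)

lemma hist_Suc: "hist e (Suc s) = sel (\<lambda>x. enters e (hist e s) s x) (Suc s) # hist e s"
  by (simp add: hist_def)

text \<open>Earlier histories are tails of later ones; this is how \<open>enters\<close> recomputes
  past approximations.\<close>

lemma drop_hist: "t \<le> s \<Longrightarrow> drop (s - t) (hist e s) = hist e t"
proof (induction s)
  case (Suc s)
  then show ?case by (cases "t = Suc s") (auto simp: hist_Suc Suc_diff_le)
qed simp

lemma entered_hist_iff: "entered (hist e s) x \<longleftrightarrow> (\<exists>t<s. x \<le> t \<and> enters e (hist e t) t x)"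
  by (induction s) (auto simp: entered_def hist_Suc set_sel less_Suc_eq)

lemma acted_iff: "acted h p \<longleftrightarrow> (\<exists>x. entered h x \<and> owner x = p)"
  by (auto simp: acted_def entered_def)

lemma entered_mono: "entered (hist e s) x \<Longrightarrow> s \<le> s' \<Longrightarrow> entered (hist e s') x"
  unfolding entered_hist_iff using less_le_trans by blast

lemma acted_mono: "acted (hist e s) p \<Longrightarrow> s \<le> s' \<Longrightarrow> acted (hist e s') p"
  unfolding acted_iff using entered_mono by blast

text \<open>Hence long stable conditions fix long initial segments, as \<open>approx_limit\<close>
  requires.\<close>

lemma length_le_enc: "length xs \<le> enc xs"
proof (induction xs)
  case (Cons x xs)
  have "enc xs \<le> enc (x, xs)" by (simp add: enc_prod_def le_prod_encode_2)
  with Cons show ?case by (simp add: enc_Cons)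
qed simp

lemma mono_bounded_eventually_const:
  fixes f :: "nat \<Rightarrow> nat"
  assumes mono: "\<And>s. s0 \<le> s \<Longrightarrow> f s \<le> f (Suc s)" and bound: "\<And>s. s0 \<le> s \<Longrightarrow> f s \<le> B"
  shows "\<exists>s1 v. \<forall>s\<ge>s1. f s = v"
proof -
  have fin: "finite (f ` {s0..})" using bound by (auto intro!: finite_subset[OF _ finite_atMost[of B]])
  have "Max (f ` {s0..}) \<in> f ` {s0..}" by (rule Max_in[OF fin]) simp
  then obtain s1 where s1: "s0 \<le> s1" "f s1 = Max (f ` {s0..})" by auto
  have "f s = f s1" if "s1 \<le> s" for s
  proof (rule antisym)
    show "f s \<le> f s1" unfolding s1(2) by (rule Max_ge[OF fin]) (use that s1(1) in simp)
    show "f s1 \<le> f s" using that 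
    proof (induction rule: dec_induct)
      case (step s)
      then have "f s \<le> f (Suc s)" using s1(1) by (intro mono) simp
      with step.IH show ?case by (rule order_trans)
    qed simp
  qed
  then show ?thesis by blast
qed

section \<open>Verification\<close>

lemma segment_le:
  assumes "alive (1 - length p mod 2) s m p"
  shows "segment s p \<le> m mod 2 ^ Suc (enc p)"
  unfolding segment_def using assms by (intro Least_le) (auto simp: alive_def)

locale permitting =
  fixes D :: "nat set" and e :: nat
  assumes mem_D_iff: "x \<in> D \<longleftrightarrow> (\<exists>s. enum e s x)"
    and not_rec_D: "\<not> rec_pred {} (\<lambda>x. x \<in> D)"
begin

definition C :: "nat \<Rightarrow> nat set" where
  "C i = {x. length (owner x) mod 2 = i \<and> (\<exists>s. entered (hist e s) x)}"

text \<open>Written as a limit inferior, which makes sense before convergence is known;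
  \<open>approx_limit\<close> shows that it is a limit.\<close>

definition Y :: "nat \<Rightarrow> nat set" where
  "Y i = {j. \<exists>s0. \<forall>s\<ge>s0. bit (approx (hist e s) s i) j}"

text \<open>The stable conditions form the true path of the construction.\<close>

definition stable :: "nat \<Rightarrow> cond \<Rightarrow> bool" where
  "stable k p \<longleftrightarrow> (\<exists>s0. \<forall>s\<ge>s0. path (hist e s) s k = p)"

section \<open>Convergence along the true path\<close>

lemma stable_length: "stable k p \<Longrightarrow> length p = k"
  unfolding stable_def by (metis length_path order_refl)

text \<open>For fixed \<open>p\<close> the class of survivors only shrinks, so its least segment can
  only increase, while staying below a fixed bound.\<close>

lemma segment_converges:
  assumes "stable k p"
  shows "\<exists>s1 v. \<forall>s\<ge>s1. segment s p = v"
proof -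
  obtain s0 where s0: "\<And>s. s0 \<le> s \<Longrightarrow> path (hist e s) s k = p"
    using assms unfolding stable_def by blast
  let ?i = "1 - length p mod 2" and ?n = "Suc (enc p)"
  have witness: "\<exists>m. alive ?i s m p \<and> m mod 2 ^ ?n = segment s p" if s: "s0 \<le> s" for s
  proof -
    have "?i < 2" by linarith
    from ex_alive_path[OF this, of s "hist e s" k] obtain m where "alive ?i s m p"
      unfolding s0[OF s] by blast
    then show ?thesis by (rule segment_witness)
  qed
  show ?thesis
  proof (rule mono_bounded_eventually_const)
    fix s assume s: "max s0 ?n \<le> s"
    obtain m where m: "alive ?i (Suc s) m p" "m mod 2 ^ ?n = segment (Suc s) p"
      using witness[of "Suc s"] s by auto
    have "alive ?i s (m mod 2 ^ s) p" using m(1) by (rule alive_mono) simp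
    then have "segment s p \<le> m mod 2 ^ s mod 2 ^ ?n" by (rule segment_le)
    also have "\<dots> = segment (Suc s) p" using s m(2) mod_mod_power[of ?n s m] by simp
    finally show "segment s p \<le> segment (Suc s) p" .
  next
    fix s assume s: "max s0 ?n \<le> s"
    then obtain m where "m mod 2 ^ ?n = segment s p" using witness[of s] by auto
    then show "segment s p \<le> 2 ^ ?n" by (metis mod_le_divisor zero_less_numeral zero_less_power)
  qed
qed

text \<open>The entry put above \<open>p\<close> prescribes this segment, and the approximation
  obeys it once the stage exceeds \<open>k\<close> and the length of the segment.\<close>

lemma approx_converges:
  assumes "stable k p"
  shows "\<exists>s1 v. \<forall>s\<ge>s1. segment s p = v \<and>
    approx (hist e s) s (1 - k mod 2) mod 2 ^ Suc (enc p) = v"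
proof -
  obtain s0 where s0: "\<And>s. s0 \<le> s \<Longrightarrow> path (hist e s) s k = p"
    using assms unfolding stable_def by blast
  obtain s1 v where v: "\<And>s. s1 \<le> s \<Longrightarrow> segment s p = v"
    using segment_converges[OF assms] by blast
  define s2 where "s2 = Max {s0, s1, Suc k, Suc (enc p)}"
  have s2: "s0 \<le> s2" "s1 \<le> s2" "k < s2" "Suc (enc p) \<le> s2" unfolding s2_def by auto
  have "segment s p = v \<and> approx (hist e s) s (1 - k mod 2) mod 2 ^ Suc (enc p) = v"
    if s: "s2 \<le> s" for s
  proof -
    have *: "segment s p = v" "path (hist e s) s k = p" using s s2 v s0 by auto
    with approx_mod_segment[of k s "hist e s"] s s2 show ?thesis by auto
  qed
  then show ?thesis by blast
qed

text \<open>Otherwise every number \<open>z\<close> lies below a realized follower, and \<open>z\<close> cannot enter \<open>D\<close> later without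
  permitting that follower; this decides \<open>D\<close>.\<close>

lemma ex_unrealized:
  assumes "stable k p" and never: "\<And>s. \<not> acted (hist e s) p"
  shows "\<exists>j. \<forall>s. \<not> realized s (enc (p, j :: nat))"
proof (rule ccontr)
  assume "\<not> ?thesis"
  then have all: "\<And>j. \<exists>s. realized s (enc (p, j :: nat))" by blast
  have k: "length p = k" using assms(1) by (rule stable_length)
  obtain s1 v where v: "\<And>s. s1 \<le> s \<Longrightarrow> approx (hist e s) s (1 - k mod 2) mod 2 ^ Suc (enc p) = v"
    using approx_converges[OF assms(1)] by blast
  \<comment> \<open>With \<open>s1 \<le> x\<close> the approximation is constant from stage
    \<open>x\<close> on, so \<open>x\<close> waits only for permission.\<close>
  define Q where "Q z s \<longleftrightarrow> (\<exists>x<Suc s. z < x \<and> s1 \<le> x \<and> owner x = p \<and> realized s x)" for z s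
  have ex: "\<exists>s. Q z s" for z
  proof -
    \<comment> \<open>A pair code is at least its second component, so followers of \<open>p\<close>
      get arbitrarily large.\<close>
    define x where "x = enc (p, z + s1 + 1)"
    have "z + s1 + 1 \<le> x" unfolding x_def by (simp add: enc_prod_def le_prod_encode_2 del: One_nat_def)
    moreover obtain s where "realized s x" using all unfolding x_def by blast
    then have "realized (max s x) x" by (rule realized_mono) simp
    moreover have "owner x = p" unfolding x_def by simp
    ultimately have "Q z (max s x)" unfolding Q_def by (intro exI[of _ x]) auto
    then show ?thesis ..
  qed
  have settled: "enum e s z" if "Q z s" "z \<in> D" for z s
  proof (rule ccontr)
    assume "\<not> enum e s z"
    obtain x where x: "x \<le> s" "z < x" "s1 \<le> x" "owner x = p" "realized s x"
      using \<open>Q z s\<close> unfolding Q_def less_Suc_eq_le by blast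
    \<comment> \<open>If \<open>z\<close> appeared in \<open>D\<close> only after stage
      \<open>s\<close>, its appearance would permit \<open>x\<close>, contrary to
      \<open>never\<close>.\<close>
    define u where "u = (LEAST u. enum e u z)"
    have u: "enum e u z" unfolding u_def using \<open>z \<in> D\<close> mem_D_iff by (auto intro: LeastI_ex)
    then have "s < u" using \<open>\<not> enum e s z\<close> enum_mono[of e u z s] by (meson not_le)
    then obtain t where t: "u = Suc t" "s \<le> t" by (cases u) auto
    have "\<not> enum e t z" using not_less_Least[of t "\<lambda>u. enum e u z"] t unfolding u_def by simp
    have "enters e (hist e t) t x"
      unfolding enters_def x(4) k
    proof (intro conjI allI impI)
      show "\<not> acted (hist e t) p" by (rule never)
      show "realized t x" using x(5) t(2) by (rule realized_mono)
      show "\<exists>z<x. enum e (Suc t) z \<and> \<not> enum e t z"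
        using x(2) u t(1) \<open>\<not> enum e t z\<close> by auto
      fix t' assume "t' < Suc t" "x \<le> t'"
      then show "approx (drop (t - t') (hist e t)) t' (1 - k mod 2) mod 2 ^ Suc (enc p) =
          approx (hist e t) t (1 - k mod 2) mod 2 ^ Suc (enc p)"
        using v[of t'] v[of t] x t(2) by (simp add: drop_hist del: power_Suc)
    qed
    then have "entered (hist e (Suc t)) x" using x(1) t(2) unfolding entered_hist_iff by auto
    then show False using never x(4) unfolding acted_iff by blast
  qed
  have "rec_pred {} (\<lambda>z. enum e (LEAST s. Q z s) z)"
    using ex unfolding Q_def
    by (intro rec_intros rec_pred_enum rec_fun_Least rec_pred_realized rec_fun_owner)
  moreover have "enum e (LEAST s. Q z s) z \<longleftrightarrow> z \<in> D" for z
    using settled[OF LeastI_ex[OF ex]] mem_D_iff by blast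
  ultimately show False using not_rec_D by simp
qed

text \<open>After an action the follower component stays 0. Otherwise the least unrealized follower
  moves only upwards and is bounded by one that is never realized. The case split is kept for the
  diagonalization.\<close>

lemma stable_Suc:
  assumes "stable k p"
  shows "\<exists>t f. stable (Suc k) ((t, f) # p) \<and> ((\<exists>s. acted (hist e s) p) \<or>
    (\<forall>s. \<not> acted (hist e s) p) \<and> (\<exists>j :: nat. f = Suc (enc (p, j))))"
proof -
  obtain s0 where s0: "\<And>s. s0 \<le> s \<Longrightarrow> path (hist e s) s k = p"
    using assms unfolding stable_def by blast
  obtain s1 v where v: "\<And>s. s1 \<le> s \<Longrightarrow> segment s p = v"
    using segment_converges[OF assms] by blast
  show ?thesis
  proof (cases "\<exists>s. acted (hist e s) p")
    case True
    then obtain sa where sa: "acted (hist e sa) p" by blast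
    have "path (hist e s) s (Suc k) = (v, 0) # p" if "max sa (max s0 s1) \<le> s" for s
      using that s0[of s] v[of s] acted_mono[OF sa, of s] by (simp add: extend_def)
    then have "stable (Suc k) ((v, 0) # p)" unfolding stable_def by blast
    with True show ?thesis by blast
  next
    case False
    then obtain j :: nat where j: "\<And>s. \<not> realized s (enc (p, j))"
      using ex_unrealized[OF assms] by blast
    have "\<exists>s2 u. \<forall>s\<ge>s2. unrealized s p = u"
    proof (rule mono_bounded_eventually_const)
      fix s :: nat
      have "Suc s \<le> unrealized (Suc s) p \<or> \<not> realized (Suc s) (enc (p, unrealized (Suc s) p))"
        unfolding unrealized_def by (rule LeastI[of _ j]) (simp add: j)
      then have "s \<le> unrealized (Suc s) p \<or> \<not> realized s (enc (p, unrealized (Suc s) p))"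
        using realized_mono[of s _ "Suc s"] by auto
      then show "unrealized s p \<le> unrealized (Suc s) p"
        unfolding unrealized_def[of s] by (rule Least_le)
      show "unrealized s p \<le> j" unfolding unrealized_def by (rule Least_le) (simp add: j)
    qed
    then obtain s2 u where u: "\<And>s. s2 \<le> s \<Longrightarrow> unrealized s p = u" by blast
    \<comment> \<open>From stage \<open>Suc u\<close> on, \<open>u\<close> is a real follower and
      not the default value of \<open>unrealized\<close>.\<close>
    have "path (hist e s) s (Suc k) = (v, Suc (enc (p, u))) # p"
      if "max (Suc u) (max s2 (max s0 s1)) \<le> s" for s
      using that s0[of s] v[of s] u[of s] False by (simp add: extend_def)
    then have "stable (Suc k) ((v, Suc (enc (p, u))) # p)" unfolding stable_def by blast
    with False show ?thesis by blast
  qed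
qed

lemma ex_stable: "\<exists>p. stable k p"
proof (induction k)
  case 0
  then show ?case by (auto simp: stable_def)
next
  case (Suc k)
  then show ?case using stable_Suc by blast
qed

section \<open>The limit sets \<open>Y i\<close>: randomness and diagonalization\<close>

lemma approx_limit:
  assumes "i < 2"
  shows "\<exists>s0. \<forall>s\<ge>s0. approx (hist e s) s i mod 2 ^ n = pre (Y i) n"
proof -
  \<comment> \<open>The parity makes entries at level \<open>k\<close> prescribe segments of
    \<open>Y i\<close>, and \<open>k\<close> is large enough for them to have at least
    \<open>n\<close> bits.\<close>
  define k where "k = 2 * n + (1 - i)"
  have k: "1 - k mod 2 = i" "n \<le> k" using less_2_cases[OF assms] unfolding k_def by auto
  obtain p where p: "stable k p" using ex_stable by blast
  define N where "N = Suc (enc p)"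
  have N: "n \<le> N" using k(2) stable_length[OF p] length_le_enc[of p] unfolding N_def by simp
  obtain s1 w where w: "\<And>s. s1 \<le> s \<Longrightarrow> approx (hist e s) s i mod 2 ^ N = w"
    using approx_converges[OF p] unfolding k(1) N_def by blast
  have bit: "bit (approx (hist e s) s i) j \<longleftrightarrow> bit w j" if "s1 \<le> s" "j < n" for s j
    using bit_mod_power[of "approx (hist e s) s i" N j] w[OF that(1)] that(2) N by simp
  have "j \<in> Y i \<longleftrightarrow> bit w j" if "j < n" for j
  proof
    assume "j \<in> Y i"
    then obtain s0 where "\<forall>s\<ge>s0. bit (approx (hist e s) s i) j" unfolding Y_def by blast
    then have "bit (approx (hist e (max s0 s1)) (max s0 s1) i) j" by simp
    then show "bit w j" using bit[of "max s0 s1" j] that by simp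
  next
    assume "bit w j"
    then show "j \<in> Y i" unfolding Y_def using bit that by blast
  qed
  then have pre: "pre (Y i) n = w mod 2 ^ n"
    by (intro bit_eqI) (auto simp: bit_mod_power)
  have "approx (hist e s) s i mod 2 ^ n = pre (Y i) n" if "s1 \<le> s" for s
    unfolding pre w[OF that, symmetric] using N by (simp add: mod_mod_power)
  then show ?thesis by blast
qed

text \<open>Rejection of an initial segment would carry over to all late approximations extending
  it, but approximations are survivors.\<close>

lemma ml_random_Y:
  assumes "i < 2"
  shows "ml_random (Y i)"
proof (rule not_null_ml_random)
  fix n
  obtain s0 where s0: "\<And>s. s0 \<le> s \<Longrightarrow> approx (hist e s) s i mod 2 ^ n = pre (Y i) n"
    using approx_limit[OF assms] by blast
  define s where "s = max s0 n"
  have "\<not> null s (approx (hist e s) s i)"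
    using alive_approx[OF assms] unfolding alive_def by blast
  then show "\<not> null n (pre (Y i) n)"
    using s0[of s] null_mono[of n "approx (hist e s) s i" s] unfolding s_def by auto
qed

lemma not_C_le_Y:
  assumes i: "i < 2"
  shows "\<not> C i \<le>\<^sub>T Y i"
proof
  assume "C i \<le>\<^sub>T Y i"
  then obtain r where r: "\<And>x. eval (Y i) r [x] (if x \<in> C i then 1 else 0)"
    unfolding turing_le_def by blast
  \<comment> \<open>The level of the requirement for program \<open>r\<close> and side
    \<open>i\<close>.\<close>
  define k where "k = 2 * rc r + i"
  have k: "k mod 2 = i" "k div 2 = rc r" using i unfolding k_def by auto
  obtain p where p: "stable k p" using ex_stable by blast
  have len: "length p = k" using p by (rule stable_length)
  obtain t f where tf: "stable (Suc k) ((t, f) # p)"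
    and cases: "(\<exists>s. acted (hist e s) p) \<or>
      (\<forall>s. \<not> acted (hist e s) p) \<and> (\<exists>j :: nat. f = Suc (enc (p, j)))"
    using stable_Suc[OF p] by blast
  obtain s1 where s1: "\<And>s. s1 \<le> s \<Longrightarrow> path (hist e s) s (Suc k) = (t, f) # p"
    using tf unfolding stable_def by blast
  have alive: "alive i s (approx (hist e s) s i) ((t, f) # p)" if "s1 \<le> s" "k < s" for s
    using alive_path_le[OF alive_approx[OF i, of s "hist e s"], of "Suc k"] that s1[OF that(1)] by simp
  have limit: "\<exists>s'. s \<le> s' \<and> s1 \<le> s' \<and> k < s' \<and> approx (hist e s') s' i mod 2 ^ s = pre (Y i) s" for s
  proof -
    obtain s0 where "\<forall>s'\<ge>s0. approx (hist e s') s' i mod 2 ^ s = pre (Y i) s"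
      using approx_limit[OF i] by blast
    then show ?thesis by (intro exI[of _ "Max {s, s0, s1, Suc k}"]) auto
  qed
  from cases show False
  proof (elim disjE conjE exE)
    fix s assume "acted (hist e s) p"
    then obtain x where x: "entered (hist e s) x" "owner x = p" unfolding acted_iff by blast
    then obtain u where "enters e (hist e u) u x" unfolding entered_hist_iff by blast
    then have "realized u x" by (simp add: enters_def)
    obtain s' where s': "u \<le> s'" "s1 \<le> s'" "k < s'"
      "approx (hist e s') s' i mod 2 ^ u = pre (Y i) u"
      using limit by blast
    \<comment> \<open>All survivors at stage \<open>u\<close> output 0 on \<open>x\<close>, and
      \<open>pre (Y i) u\<close> is one of them, as a truncation of a later survivor.\<close>
    have "alive i s' (approx (hist e s') s' i) p" using alive[OF s'(2,3)] by (simp add: alive_Cons)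
    then have "alive i u (pre (Y i) u) p" unfolding s'(4)[symmetric] using s'(1) by (rule alive_mono)
    with \<open>realized u x\<close> have "halts0 (rc r) u (pre (Y i) u) x"
      using pre_less unfolding realized_def x(2) len k by blast
    then have "eval (Y i) r [x] 0" by (rule halts0_sound)
    moreover have "x \<in> C i" unfolding C_def using x len k by auto
    ultimately show False using eval_det[OF _ r[of x], of 0] by auto
  next
    fix j :: nat assume never: "\<forall>s. \<not> acted (hist e s) p" and f: "f = Suc (enc (p, j))"
    let ?x = "enc (p, j)"
    have "?x \<notin> C i" using never owner_enc[of p j] unfolding C_def acted_iff by blast
    then have "eval (Y i) r [?x] 0" using r[of ?x] by simp
    then obtain s where s: "halts0 (rc r) s (pre (Y i) s) ?x" using halts0_complete by blast
    obtain s' where s': "s \<le> s'" "s1 \<le> s'" "k < s'"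
      "approx (hist e s') s' i mod 2 ^ s = pre (Y i) s"
      using limit by blast
    \<comment> \<open>The entry \<open>f\<close> forbids this computation.\<close>
    have "halts0 (rc r) s' (approx (hist e s') s' i) ?x"
      by (rule halts0_mono[OF _ s'(1)]) (simp add: s'(4) s)
    moreover have "meets i s' (approx (hist e s') s' i) ((t, f) # p)"
      using alive[OF s'(2,3)] by (simp add: alive_Cons)
    ultimately show False using k len f by (simp add: meets_def)
  qed
qed

section \<open>The sets \<open>C i\<close> and their reductions to \<open>D\<close> and to the
  random sets\<close>

lemma ce_C: "ce (C i)"
proof -
  have "ce {x. \<exists>s. length (owner x) mod 2 = i \<and> entered (hist e s) x}"
    by (intro ce_ex rec_intros rec_fun_owner rec_pred_entered rec_fun_hist)
  then show ?thesis by (simp add: C_def)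
qed

text \<open>Permitting: \<open>x\<close> enters only when some \<open>z < x\<close> enters
  \<open>D\<close>, so its fate is decided once \<open>D\<close> has been enumerated completely
  below \<open>x\<close>.\<close>

lemma C_le_D: "C i \<le>\<^sub>T D"
proof -
  let ?Q = "\<lambda>x s. \<forall>z<x. z \<in> D \<longrightarrow> enum e s z"
  have ex: "\<exists>s. ?Q x s" for x
  proof (induction x)
    case (Suc x)
    then obtain s where s: "?Q x s" by blast
    obtain t where t: "x \<in> D \<longrightarrow> enum e t x" using mem_D_iff by blast
    have "?Q (Suc x) (max s t)"
      using s t enum_mono[of e s _ "max s t"] enum_mono[of e t _ "max s t"] by (auto simp: less_Suc_eq)
    then show ?case ..
  qed simp
  have "rec_pred D (\<lambda>x. length (owner x) mod 2 = i \<and> entered (hist e (LEAST s. ?Q x s)) x)"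
    using ex by (intro rec_intros rec_fun_owner rec_pred_entered rec_fun_hist rec_fun_Least
        rec_pred_mem_oracle rec_pred_enum)
  moreover have "entered (hist e (LEAST s. ?Q x s)) x" if entered: "entered (hist e u) x" for x u
  proof -
    let ?S = "LEAST s. ?Q x s"
    obtain t where t: "x \<le> t" "enters e (hist e t) t x"
      using entered unfolding entered_hist_iff by blast
    then obtain z where z: "z < x" "enum e (Suc t) z" "\<not> enum e t z" unfolding enters_def by blast
    have "?Q x ?S" using ex by (rule LeastI_ex)
    then have "enum e ?S z" using z mem_D_iff by blast
    then have "t < ?S" using z(3) enum_mono[of e ?S z t] by (meson not_le)
    with t show ?thesis unfolding entered_hist_iff by blast
  qed
  then have "x \<in> C i \<longleftrightarrow> length (owner x) mod 2 = i \<and> entered (hist e (LEAST s. ?Q x s)) x" for x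
    unfolding C_def by auto
  ultimately show ?thesis unfolding turing_le_iff by simp
qed

lemma rec_pred_finite:
  assumes "finite F"
  shows "rec_pred X (\<lambda>x :: nat. x \<in> F)"
  using assms
proof (induction F rule: finite_induct)
  case (insert a F)
  then have "rec_pred X (\<lambda>x. x = a \<or> x \<in> F)" by (intro rec_pred_disj rec_intros)
  then show ?case by simp
qed (simp add: rec_pred_const)

text \<open>The first entry of a follower blocks its owner at all later stages; several followers of
  one owner may enter at the same stage.\<close>

lemma enters_same_stage:
  assumes "enters e (hist e s) s x" "x \<le> s" "enters e (hist e s') s' x'" "x' \<le> s'" "owner x = owner x'"
  shows "s = s'"
proof -
  have less: False if "enters e (hist e s) s x" "x \<le> s" "enters e (hist e s') s' x'" "owner x = owner x'" "s < s'"
    for s x s' x'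
  proof -
    have "entered (hist e s') x" using that unfolding entered_hist_iff by blast
    then have "acted (hist e s') (owner x')" using that unfolding acted_iff by auto
    with that show False unfolding enters_def by blast
  qed
  show ?thesis using less[of s x s' x'] less[of s' x' s x] assms by (metis linorder_neqE_nat)
qed

text \<open>All followers of one owner enter at a single stage \<open>s\<close> and are at most
  \<open>s\<close>; only finitely many owners have a code below the bound.\<close>

lemma finite_owner_less: "finite {x. (\<exists>s. entered (hist e s) x) \<and> Suc (enc (owner x)) < N}"
proof -
  have fin: "finite {x. (\<exists>s. entered (hist e s) x) \<and> owner x = p}" for p
  proof (cases "\<exists>x s. entered (hist e s) x \<and> owner x = p")
    case True
    then obtain y s where y: "enters e (hist e s) s y" "y \<le> s" "owner y = p"
      unfolding entered_hist_iff by blast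
    have "x \<le> s" if u: "entered (hist e u) x" "owner x = p" for u x
    proof -
      obtain s' where s': "enters e (hist e s') s' x" "x \<le> s'"
        using u unfolding entered_hist_iff by blast
      have "s = s'" using y s' u(2) by (intro enters_same_stage[of s y s' x]) auto
      with s' show ?thesis by simp
    qed
    then show ?thesis by (intro finite_subset[OF _ finite_atMost[of s]]) auto
  next
    case False
    then have empty: "{x. (\<exists>s. entered (hist e s) x) \<and> owner x = p} = {}" by blast
    show ?thesis unfolding empty by simp
  qed
  have "{x. (\<exists>s. entered (hist e s) x) \<and> Suc (enc (owner x)) < N}
      \<subseteq> (\<Union>c<N. {x. (\<exists>s. entered (hist e s) x) \<and> owner x = dec c})"
  proof clarify
    fix x s assume "entered (hist e s) x" "Suc (enc (owner x)) < N"
    then show "x \<in> (\<Union>c<N. {x. (\<exists>s. entered (hist e s) x) \<and> owner x = dec c})"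
      by (intro UN_I[of "enc (owner x)"]) auto
  qed
  then show ?thesis by (rule finite_subset) (intro finite_UN_I finite_lessThan fin)
qed

text \<open>The initial segments of the approximation to \<open>Y\<^sub>1\<^sub>-\<^sub>i\<close> present when a number enters \<open>C\<^sub>i\<close> form a
  test as in \<open>ml_random_avoids\<close>. So, with finitely many exceptions, \<open>x\<close> can no longer enter \<open>C\<^sub>i\<close> once the
  approximation has agreed with \<open>Y\<^sub>1\<^sub>-\<^sub>i\<close> at some stage \<open>\<ge> x\<close>.\<close>

lemma C_le_Y:
  assumes i: "i < 2"
  shows "C i \<le>\<^sub>T Y (1 - i)"
proof -
  let ?Y = "Y (1 - i)" and ?l = "\<lambda>x. Suc (enc (owner x))"
  have i': "1 - i < 2" by simp
  define R where "R s l v \<longleftrightarrow> (\<exists>x<Suc s. enters e (hist e s) s x \<and> length (owner x) mod 2 = i \<and>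
    l = ?l x \<and> v = approx (hist e s) s (1 - i) mod 2 ^ l)" for s l v
  have "rec_pred {} (\<lambda>z. R (fst z) (fst (snd z)) (snd (snd z)))"
    unfolding R_def by (intro rec_intros rec_pred_enters rec_fun_owner rec_fun_hist rec_fun_approx)
  moreover have "v = v'" if R: "R s l v" "R s' l v'" for s s' l v v'
  proof -
    obtain x x' where x: "x \<le> s" "enters e (hist e s) s x" "l = ?l x"
      "v = approx (hist e s) s (1 - i) mod 2 ^ l"
      "x' \<le> s'" "enters e (hist e s') s' x'" "l = ?l x'"
      "v' = approx (hist e s') s' (1 - i) mod 2 ^ l"
      using R unfolding R_def less_Suc_eq_le by blast
    \<comment> \<open>The segment length determines the owner, and the owner determines the stage,
      so only one string of each length is recorded.\<close>
    have "owner x = owner x'" using x(3,7) by simp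
    then have "s = s'" using x by (intro enters_same_stage[of s x s' x'])
    with x show ?thesis by simp
  qed
  ultimately obtain N where N: "\<And>s l v. N \<le> l \<Longrightarrow> R s l v \<Longrightarrow> pre ?Y l \<noteq> v"
    using ml_random_avoids[OF ml_random_Y[OF i'], of R] by blast
  \<comment> \<open>Members with segments too short for the bound \<open>N\<close>; this finite set
    is hardwired into the reduction.\<close>
  define F where "F = {x. (\<exists>s. entered (hist e s) x) \<and> ?l x < N}"
  let ?Q = "\<lambda>x t. x \<le> t \<and> approx (hist e t) t (1 - i) mod 2 ^ ?l x = pre ?Y (?l x)"
  have ex: "\<exists>t. ?Q x t" for x
  proof -
    obtain s0 where "\<forall>s\<ge>s0. approx (hist e s) s (1 - i) mod 2 ^ ?l x = pre ?Y (?l x)"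
      using approx_limit[OF i'] by blast
    then show ?thesis by (intro exI[of _ "max s0 x"]) simp
  qed
  have "rec_pred ?Y (\<lambda>x. length (owner x) mod 2 = i \<and>
      (if ?l x < N then x \<in> F else entered (hist e (LEAST t. ?Q x t)) x))"
    using ex finite_owner_less unfolding F_def
    by (intro rec_pred_finite rec_intros rec_fun_owner rec_pred_entered rec_fun_hist rec_fun_Least rec_fun_approx
        rec_fun_pre)
  moreover have "entered (hist e (LEAST t. ?Q x t)) x"
    if x: "entered (hist e u) x" "length (owner x) mod 2 = i" "N \<le> ?l x" for x u
  proof (rule ccontr)
    let ?T = "LEAST t. ?Q x t"
    assume not: "\<not> entered (hist e ?T) x"
    have T: "?Q x ?T" using ex by (rule LeastI_ex)
    obtain s where s: "x \<le> s" "enters e (hist e s) s x"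
      using x(1) unfolding entered_hist_iff by blast
    with not have "?T \<le> s" unfolding entered_hist_iff by (meson not_le)
    \<comment> \<open>Stage \<open>?T\<close> lies between \<open>x\<close> and \<open>s\<close>, so
      the constancy demand in \<open>enters\<close> carries the true segment of \<open>?Y\<close> to
      stage \<open>s\<close>, where \<open>R\<close> records it.\<close>
    then have "approx (drop (s - ?T) (hist e s)) ?T (1 - i) mod 2 ^ ?l x =
        approx (hist e s) s (1 - i) mod 2 ^ ?l x"
      using s(2) T x(2) unfolding enters_def less_Suc_eq_le by blast
    then have "pre ?Y (?l x) = approx (hist e s) s (1 - i) mod 2 ^ ?l x"
      using T drop_hist[OF \<open>?T \<le> s\<close>] by simp
    moreover have "R s (?l x) (approx (hist e s) s (1 - i) mod 2 ^ ?l x)"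
      unfolding R_def using s x(2) by (intro exI[of _ x]) simp
    ultimately show False using N[OF x(3)] by blast
  qed
  then have "x \<in> C i \<longleftrightarrow> length (owner x) mod 2 = i \<and>
      (if ?l x < N then x \<in> F else entered (hist e (LEAST t. ?Q x t)) x)" for x
    unfolding C_def F_def by (auto simp del: pre.simps power_Suc)
  ultimately show ?thesis unfolding turing_le_iff by simp
qed

end

theorem theorem5p15:
  fixes D :: "nat set"
  assumes "ce D" and "\<not> computable D"
  shows "\<exists>A B. ce A \<and> ce B \<and> A \<le>\<^sub>T D \<and> B \<le>\<^sub>T D \<and> \<not> (A \<le>\<^sub>M\<^sub>L B) \<and> \<not> (B \<le>\<^sub>M\<^sub>L A)"
proof -
  obtain e where "\<And>x. x \<in> D \<longleftrightarrow> (\<exists>s. enum e s x)"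
    using ce_enum[OF assms(1)] by blast
  then interpret permitting D e
    using assms(2) by unfold_locales (simp_all add: computable_def turing_le_iff)
  \<comment> \<open>The random set \<open>Y 0\<close> computes \<open>C 1\<close> but not
    \<open>C 0\<close>, and \<open>Y 1\<close> computes \<open>C 0\<close> but not
    \<open>C 1\<close>.\<close>
  have "\<not> (C 0 \<le>\<^sub>M\<^sub>L C 1)" "\<not> (C 1 \<le>\<^sub>M\<^sub>L C 0)"
    unfolding ml_le_def using ml_random_Y[of 0] ml_random_Y[of 1] not_C_le_Y[of 0] not_C_le_Y[of 1]
      C_le_Y[of 0] C_le_Y[of 1] by auto
  then show ?thesis using ce_C C_le_D by blast
qed

end
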